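(* For each integer $i\ge 1$, let $b_i$ be the number of rooted trees $T$ (up to isomorphism of rooted trees) with exactly $i$ vertices such that $T=B_{m,p}\cdot B_{n,q}$ for some integers $m,n>0$ and $p,q\geq 0$ and such that the poset $C(T,r)$ is not rank unimodal, where $r$ is the root of $T$. Then $b_1=b_2=\cdots=b_9=0$, and for every integer $k\geq 0$ $$b_{2k+10}=2\left(\sum_{i=0}^{k}\left\lfloor\frac{i(i+4)}{4}\right\rfloor\right)-\left\lfloor\frac{k^2}{4}\right\rfloor,$$ $$b_{2k+11}=2\left(\sum_{i=0}^{k}\left\lfloor\frac{i(i+4)}{4}\right\rfloor\right)+\left\lfloor\frac{(k+1)(k+5)}{4}\right\rfloor-\left\lfloor\frac{k^2}{4}\right\rfloor.$$
   Context: For integers $m>0$ and $k\ge 0$, the broom graph $B_{m,k}$ is the rooted tree consisting of a path $x_0,x_1,\ldots,x_k$ with $k$ edges, rooted at $x_0$, together with $m$ additional pendant vertices each adjacent to $x_k$ (all edges directed away from the root). The merge $T_1\cdot T_2$ of two rooted trees is the rooted tree obtained from their disjoint union by identifying the two roots; the identified vertex is the root. For a rooted tree $T$ with root $r$, $C(T,r)$ is the poset of connected vertex-induced subtrees of $T$ containing $r$, ordered by inclusion. Its rank sequence is $(r_i)_{i\ge 1}$, where $r_i$ is the number of connected vertex-induced subtrees of $T$ containing the root with exactly $i$ vertices. The poset is rank unimodal if $(r_i)$ is unimodal, i.e. if for some $k$ we have $r_1\le\cdots\le r_k\ge r_{k+1}\ge\cdots$. *)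

theory Defs
  imports "Graph_Theory.Graph_Theory"
begin

record 'a rooted_digraph =
  graph_of :: "'a pair_pre_digraph"
  root_of :: 'a

abbreviation rverts :: "'a rooted_digraph \<Rightarrow> 'a set" where
  "rverts T \<equiv> pverts (graph_of T)"

abbreviation rarcs :: "'a rooted_digraph \<Rightarrow> ('a \<times> 'a) set" where
  "rarcs T \<equiv> parcs (graph_of T)"

abbreviation rdigraph :: "'a rooted_digraph \<Rightarrow> ('a, 'a \<times> 'a) pre_digraph" where
  "rdigraph T \<equiv> with_proj (graph_of T)"

text \<open>
  A rooted tree is a finite digraph whose edges are directed away from the root: every vertex is
  reached from the root by exactly one directed walk. The constant \<^const>\<open>tree\<close> of the library
  does not serve here, since it only excludes directed cycles: the arcs \<open>(0,1)\<close>, \<open>(0,2)\<close>,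
  \<open>(1,3)\<close>, \<open>(2,3)\<close> form a \<^const>\<open>tree\<close> in its sense.
\<close>

definition rooted_tree :: "'a rooted_digraph \<Rightarrow> bool" where
  "rooted_tree T \<longleftrightarrow> fin_digraph (rdigraph T) \<and> root_of T \<in> rverts T \<and>
     (\<forall>v \<in> rverts T. \<exists>!p. pre_digraph.awalk (rdigraph T) (root_of T) p v)"

definition rooted_iso :: "'a rooted_digraph \<Rightarrow> 'b rooted_digraph \<Rightarrow> bool" where
  "rooted_iso T T' \<longleftrightarrow>
     (\<exists>h. pre_digraph.digraph_isomorphism (rdigraph T) h \<and> rdigraph T' = app_iso h (rdigraph T) \<and>
          iso_verts h (root_of T) = root_of T')"

text \<open>
  The broom \<open>B\<^sub>m\<^sub>,\<^sub>k\<close>: the path vertex \<open>x\<^sub>i\<close> is the number \<open>i\<close>, and the \<open>m\<close> pendant vertices are the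
  numbers \<open>k + 1, \<dots>, k + m\<close>.
\<close>

definition broom :: "nat \<Rightarrow> nat \<Rightarrow> nat rooted_digraph" where
  "broom m k =
     \<lparr> graph_of = \<lparr> pverts = {0..k + m},
                    parcs = {(i, i + 1) | i. i < k} \<union> {(k, j) | j. k < j \<and> j \<le> k + m} \<rparr>,
       root_of = 0 \<rparr>"

text \<open>
  The root of \<open>T\<^sub>2\<close> is represented by the root of \<open>T\<^sub>1\<close>; all other vertices are kept apart by the
  disjoint sum.
\<close>

definition merge_inr :: "'a rooted_digraph \<Rightarrow> 'b rooted_digraph \<Rightarrow> 'b \<Rightarrow> 'a + 'b" where
  "merge_inr T\<^sub>1 T\<^sub>2 v = (if v = root_of T\<^sub>2 then Inl (root_of T\<^sub>1) else Inr v)"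

definition rooted_merge ::
    "'a rooted_digraph \<Rightarrow> 'b rooted_digraph \<Rightarrow> ('a + 'b) rooted_digraph" where
  "rooted_merge T\<^sub>1 T\<^sub>2 =
     \<lparr> graph_of =
         \<lparr> pverts = Inl ` rverts T\<^sub>1 \<union> merge_inr T\<^sub>1 T\<^sub>2 ` rverts T\<^sub>2,
           parcs = map_prod Inl Inl ` rarcs T\<^sub>1 \<union>
                   map_prod (merge_inr T\<^sub>1 T\<^sub>2) (merge_inr T\<^sub>1 T\<^sub>2) ` rarcs T\<^sub>2 \<rparr>,
       root_of = Inl (root_of T\<^sub>1) \<rparr>"

text \<open>
  The elements of the poset \<open>C(T,r)\<close>. Connectedness is that of the underlying undirected graph, as
  in the library. The order (inclusion) enters the rank sequence only through the number of
  vertices of a subtree, so it is not named separately.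
\<close>

definition root_subtrees :: "'a rooted_digraph \<Rightarrow> ('a, 'a \<times> 'a) pre_digraph set" where
  "root_subtrees T =
     {H. induced_subgraph H (rdigraph T) \<and> Digraph_Component.connected H \<and> root_of T \<in> verts H}"

definition rank_number :: "'a rooted_digraph \<Rightarrow> nat \<Rightarrow> nat" where
  "rank_number T i = card {H \<in> root_subtrees T. card (verts H) = i}"

text \<open>Sequences are indexed from 1; the value at 0 is irrelevant.\<close>

definition unimodal :: "(nat \<Rightarrow> nat) \<Rightarrow> bool" where
  "unimodal r \<longleftrightarrow>
     (\<exists>k\<ge>1. (\<forall>i. 1 \<le> i \<and> i < k \<longrightarrow> r i \<le> r (i + 1)) \<and> (\<forall>i\<ge>k. r (i + 1) \<le> r i))"

definition rank_unimodal :: "'a rooted_digraph \<Rightarrow> bool" where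
  "rank_unimodal T \<longleftrightarrow> unimodal (rank_number T)"

text \<open>
  Every finite rooted tree is isomorphic to one on natural numbers, so isomorphism types are
  counted as isomorphism classes of the latter. There are only finitely many with \<open>i\<close> vertices,
  hence \<^const>\<open>card\<close> is the true number.
\<close>

definition non_unimodal_broom_merges :: "nat \<Rightarrow> nat rooted_digraph set" where
  "non_unimodal_broom_merges i =
     {T. rooted_tree T \<and> card (rverts T) = i \<and>
         (\<exists>m n p q. m > 0 \<and> n > 0 \<and> rooted_iso T (rooted_merge (broom m p) (broom n q))) \<and>
         \<not> rank_unimodal T}"

definition b_seq :: "nat \<Rightarrow> nat" where
  "b_seq i = card (non_unimodal_broom_merges i // {(T, T'). rooted_iso T T'})"

end

theory Submission
  imports Defs "HOL-Computational_Algebra.Formal_Power_Series" "HOL-Library.Nat_Bijection"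
begin

text \<open>
  A connected subtree containing the root is the same as a set of vertices that contains the root
  and is closed under taking parents; hence \<open>B\<^sub>m\<^sub>,\<^sub>p\<close> has rank generating function
  \<open>(1 - x\<^sup>p) / (1 - x) + x\<^sup>p (1 + x)\<^sup>m\<close> (the exponent being the number of vertices minus one),
  and a merge has the product of the generating functions.

  Multiplied by \<open>1 - x\<close>, the product for \<open>B\<^sub>m\<^sub>,\<^sub>p \<cdot> B\<^sub>n\<^sub>,\<^sub>q\<close> becomes explicit. If \<open>n \<le> p\<close> and \<open>m \<le> q\<close>,
  its coefficients at \<open>p + q + 1\<close> and \<open>p + q + 2\<close> are \<open>-1\<close> and \<open>(m - 1) (n - 1) - 1\<close>, so unimodality
  fails if \<open>m, n \<ge> 2\<close> and \<open>m + n \<ge> 5\<close>. In all other cases the coefficients change sign only once: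
  if \<open>p < n\<close> or \<open>q < m\<close> they are nonnegative up to \<open>p + q + 1\<close>, and beyond that, for \<open>m \<le> n\<close>, they
  are bounded below by ballot-type numbers which are nonnegative up to \<open>p + q + m\<close>, after which a
  quotient that first increases and then decreases controls the sign.

  The set of pairs (depth, number of children) of the branching vertices other than the root
  is an isomorphism invariant which recovers the unordered pair of brooms from a merge that is not
  rank unimodal. So the classes are counted by unordered pairs of pairs \<open>(p, m)\<close>, \<open>(q, n)\<close>, that is,
  by half of the number of ordered pairs plus the number of diagonal ones.
\<close>

section \<open>Sign changes of the differenced rank sequence\<close>

lemma fps_nth_one_plus_X_power: "fps_nth ((1 + fps_X :: int fps) ^ n) k = int (n choose k)"
proof (induction n arbitrary: k)
  case (Suc n)
  show ?case
    by (cases k) (simp_all add: Suc distrib_right)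
qed (auto simp: fps_one_nth)

section \<open>Generating functions of brooms and merges, and the differenced product\<close>

definition broom_coeff :: "nat \<Rightarrow> nat \<Rightarrow> nat \<Rightarrow> nat" where
  "broom_coeff m p i = (if i < p then 1 else m choose (i - p))"

definition merge_coeff :: "nat \<Rightarrow> nat \<Rightarrow> nat \<Rightarrow> nat \<Rightarrow> nat \<Rightarrow> nat" where
  "merge_coeff m p n q i = (\<Sum>k\<le>i. broom_coeff m p k * broom_coeff n q (i - k))"

definition broom_fps :: "nat \<Rightarrow> nat \<Rightarrow> int fps" where
  "broom_fps m p = Abs_fps (\<lambda>i. int (broom_coeff m p i))"

text \<open>Multiplication by \<open>1 - fps_X\<close> takes differences: for positive
  \<open>i\<close> this is the rank number at \<open>i + 1\<close> minus the one at
  \<open>i\<close>.\<close>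

definition merge_diff :: "nat \<Rightarrow> nat \<Rightarrow> nat \<Rightarrow> nat \<Rightarrow> nat \<Rightarrow> int" where
  "merge_diff m p n q i = fps_nth ((1 - fps_X) * (broom_fps m p * broom_fps n q)) i"

lemma merge_diff_Suc:
  "merge_diff m p n q (Suc i) = int (merge_coeff m p n q (Suc i)) - int (merge_coeff m p n q i)"
proof -
  have "(1 - fps_X) * (broom_fps m p * broom_fps n q)
      = broom_fps m p * broom_fps n q - fps_X * (broom_fps m p * broom_fps n q)"
    by (simp add: left_diff_distrib)
  moreover have "fps_nth (broom_fps m p * broom_fps n q) i = int (merge_coeff m p n q i)" for i
    by (simp add: fps_mult_nth broom_fps_def merge_coeff_def atMost_atLeast0)
  ultimately show ?thesis
    by (simp add: merge_diff_def del: mult.assoc)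
qed

lemma merge_diff_commute: "merge_diff m p n q = merge_diff n q m p"
  by (simp add: merge_diff_def fun_eq_iff mult.commute)

definition geom_fps :: "nat \<Rightarrow> int fps" where
  "geom_fps p = (\<Sum>i<p. fps_X ^ i)"

lemma geom_fps_nth: "fps_nth (geom_fps p) i = (if i < p then 1 else 0)"
  by (simp add: geom_fps_def fps_sum_nth fps_X_power_nth)

lemma broom_fps_eq: "broom_fps m p = geom_fps p + fps_X ^ p * (1 + fps_X) ^ m"
  by (rule fps_ext)
    (auto simp: broom_fps_def broom_coeff_def geom_fps_nth fps_X_power_mult_nth
        fps_nth_one_plus_X_power)

text \<open>A geometric factor telescopes against \<open>1 - fps_X\<close>. In the product of the
  two geometric factors only one cancels; the surviving \<open>geom_fps q\<close> yields the two
  indicator terms.\<close>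

lemma merge_diff_eq:
  "merge_diff m p n q i =
     (if i < q then 1 else 0) - (if p \<le> i \<and> i < p + q then 1 else 0)
     + (if p \<le> i then int (m choose (i - p)) else 0)
     + (if q \<le> i then int (n choose (i - q)) else 0)
     + (if p + q \<le> i then int ((m + n) choose (i - (p + q)))
          - int (m choose (i - (p + q))) - int (n choose (i - (p + q))) else 0)
     - (if p + q < i then int ((m + n) choose (i - (p + q) - 1)) else 0)"
proof -
  define u v :: "int fps" where "u = (1 + fps_X) ^ m" and "v = (1 + fps_X) ^ n"
  have geom: "(1 - fps_X) * geom_fps k = 1 - fps_X ^ k" for k
    unfolding geom_fps_def by (simp only: one_diff_power_eq)
  have "(1 - fps_X) * (broom_fps m p * broom_fps n q) =
      ((1 - fps_X) * geom_fps p) * geom_fps q + ((1 - fps_X) * geom_fps p) * (fps_X ^ q * v)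
      + ((1 - fps_X) * geom_fps q) * (fps_X ^ p * u)
      + (1 - fps_X) * (fps_X ^ p * fps_X ^ q * (u * v))"
    unfolding broom_fps_eq u_def v_def by (simp add: algebra_simps)
  also have "\<dots> = geom_fps q - fps_X ^ p * geom_fps q + fps_X ^ p * u + fps_X ^ q * v
      + fps_X ^ (p + q) * (u * v) - fps_X ^ (p + q) * u - fps_X ^ (p + q) * v
      - fps_X ^ (p + q + 1) * (u * v)"
    unfolding geom by (simp add: algebra_simps power_add)
  also have "u * v = (1 + fps_X) ^ (m + n)"
    by (simp add: u_def v_def power_add)
  finally show ?thesis
    unfolding merge_diff_def u_def v_def
    by (auto simp: fps_X_power_mult_nth fps_nth_one_plus_X_power geom_fps_nth simp del: power_Suc)
qed

text \<open>The differences beyond \<open>p + q\<close>, re-indexed from 1. At \<open>j = 0\<close>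
  the truncated \<open>j - 1\<close> would give a spurious term, hence \<open>j > 0\<close> in
  \<open>merge_diff_tail\<close>.\<close>

definition merge_tail :: "nat \<Rightarrow> nat \<Rightarrow> nat \<Rightarrow> nat \<Rightarrow> nat \<Rightarrow> int" where
  "merge_tail m p n q j = int ((m + n) choose j) - int ((m + n) choose (j - 1))
     - int (m choose j) - int (n choose j) + int (m choose (q + j)) + int (n choose (p + j))"

lemma merge_diff_tail: "j > 0 \<Longrightarrow> merge_diff m p n q (p + q + j) = merge_tail m p n q j"
  by (simp add: merge_diff_eq merge_tail_def add.commute)

section \<open>Ballot numbers compared with binomial coefficients\<close>

text \<open>Truncated subtraction makes the value at \<open>j = 0\<close> equal to 0 rather than 1,
  so the Pascal rule below starts at \<open>j = 1\<close>.\<close>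

definition ballot :: "nat \<Rightarrow> nat \<Rightarrow> int" where
  "ballot N j = int (N choose j) - int (N choose (j - 1))"

definition ballot_gap :: "nat \<Rightarrow> nat \<Rightarrow> nat \<Rightarrow> int" where
  "ballot_gap m n j = ballot (m + n) j - int (m choose j) - int (n choose j)"

lemma ballot_Suc_Suc: "j \<ge> 1 \<Longrightarrow> ballot (Suc N) (Suc j) = ballot N (Suc j) + ballot N j"
  by (cases j) (auto simp: ballot_def)

lemma ballot_gap_commute: "ballot_gap m n j = ballot_gap n m j"
  by (simp add: ballot_gap_def add.commute)

lemma ballot_gap_Suc:
  "j \<ge> 1 \<Longrightarrow> ballot_gap (Suc m) n (Suc j) = ballot_gap m n (Suc j) + ballot_gap m n j + int (n choose j)"
  by (simp add: ballot_gap_def ballot_Suc_Suc)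

lemma ballot_gap_1: "ballot_gap m n (Suc 0) = -1"
  by (simp add: ballot_gap_def ballot_def)

text \<open>Induction on \<open>m + n\<close> by Pascal's rule, applied to an argument larger than
  \<open>j\<close>. Index 1 contributes -1, which the positive binomial coefficient of the
  recurrence absorbs; the corner \<open>m = n = j\<close> is treated separately.\<close>

lemma ballot_gap_nonneg:
  assumes "2 \<le> j" "j \<le> m" "j \<le> n"
  shows "ballot_gap m n j \<ge> 0"
  using assms
proof (induction "m + n" arbitrary: m n j rule: less_induct)
  case less
  obtain i where i: "j = Suc i" "1 \<le> i"
    using less.prems by (cases j) auto
  have ge: "ballot_gap m' n' i \<ge> -1" if "m' + n' < m + n" "i \<le> m'" "i \<le> n'" for m' n'
    using less.hyps[of m' n' i] that i ballot_gap_1[of m' n'] by (cases "i = 1") force+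
  have step: "ballot_gap m n j \<ge> 0"
    if IH: "\<And>m' n'. m' + n' < m + n \<Longrightarrow> j \<le> m' \<Longrightarrow> j \<le> n' \<Longrightarrow> ballot_gap m' n' j \<ge> 0"
      and ge: "\<And>m' n'. m' + n' < m + n \<Longrightarrow> i \<le> m' \<Longrightarrow> i \<le> n' \<Longrightarrow> ballot_gap m' n' i \<ge> -1"
      and "j < m" "j \<le> n" for m n
  proof -
    obtain l where l: "m = Suc l" "j \<le> l"
      using \<open>j < m\<close> by (cases m) auto
    have "int (n choose i) \<ge> 1"
      using that(4) i by (simp add: Suc_le_eq)
    then show ?thesis
      using ballot_gap_Suc[of i l n] IH[of l n] ge[of l n] l i that(4) by simp
  qed
  consider "j < m" | "j < n" | "m = j" "n = j"
    using less.prems by linarith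
  then show ?case
  proof cases
    case 1
    show ?thesis
      by (rule step[OF less.hyps ge]) (use 1 less.prems in simp_all)
  next
    case 2
    have "ballot_gap n m j \<ge> 0"
      by (rule step[OF less.hyps ge]) (use 2 less.prems in simp_all)
    then show ?thesis by (simp add: ballot_gap_commute)
  next
    case 3
    \<comment> \<open>With \<open>j = i + 1\<close> these are the two central entries of an odd row,
      so the ballot number vanishes and \<open>-(j choose j)\<close> remains. The recurrence then
      gives at least \<open>-1 - 1 + j\<close>, where \<open>j \<ge> 2\<close>.\<close>
    have "(i + j) choose j = (i + j) choose i"
      using binomial_symmetric[of j "i + j"] by simp
    then have "ballot_gap i j j = -1"
      by (simp add: ballot_gap_def ballot_def i(1))
    moreover have "int (j choose i) = int j"
      by (simp add: i)
    ultimately show ?thesis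
      using ballot_gap_Suc[of i i j] ge[of i j] i 3 less.prems by simp
  qed
qed

text \<open>Written over the integers so that no side condition arises: for \<open>j > n\<close>
  both sides vanish.\<close>

lemma Suc_times_binomial_Suc: "int (Suc j) * int (n choose Suc j) = (int n - int j) * int (n choose j)"
proof (cases "j \<le> n")
  case True
  have "Suc j * (n choose Suc j) = (n - j) * (n choose j)"
    using binomial_absorb_comp[of n j] binomial_absorption[of j "n"] 
    by metis
  then show ?thesis
    using True by (metis of_nat_diff of_nat_mult)
next
  case False
  then show ?thesis by (simp add: binomial_eq_0)
qed


text \<open>The quotient of consecutive ballot numbers, with denominators cleared so that zeros
  cause no trouble.\<close>

lemma ballot_Suc:
  assumes "j \<ge> 1"
  shows "int (Suc j) * (int N + 1 - 2 * int j) * ballot N (Suc j)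
    = (int N - 1 - 2 * int j) * (int N + 1 - int j) * ballot N j"
proof -
  obtain i where i: "j = Suc i" using assms by (cases j) auto
  define a b c where "a = int (N choose i)" and "b = int (N choose Suc i)" and "c = int (N choose Suc (Suc i))"
  define x where "x = int i"
  have b: "(x + 1) * b = (int N - x) * a" and c: "(x + 2) * c = (int N - x - 1) * b"
    using Suc_times_binomial_Suc[of i N] Suc_times_binomial_Suc[of "Suc i" N]
    by (simp_all add: a_def b_def c_def x_def algebra_simps)
  \<comment> \<open>The difference of the two sides is a combination of the binomial quotient
    identities \<open>b\<close> and \<open>c\<close>.\<close>
  have "(x + 2) * (int N - 1 - 2 * x) * (c - b) - (int N - 3 - 2 * x) * (int N - x) * (b - a)
    = (int N - 1 - 2 * x) * ((x + 2) * c - (int N - x - 1) * b) - (int N - 3 - 2 * x) * ((x + 1) * b - (int N - x) * a)"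
    by (simp add: algebra_simps)
  also have "\<dots> = 0"
    by (simp add: b c)
  finally show ?thesis
    by (simp add: i ballot_def a_def b_def c_def x_def algebra_simps)
qed

lemma ballot_nonpos: "N < 2 * j \<Longrightarrow> ballot N j \<le> 0"
proof (cases "j \<le> N")
  case True
  assume "N < 2 * j"
  then have "N choose j \<le> N choose (j - 1)"
    using True binomial_antimono[of "j - 1" j N] by simp
  then show ?thesis by (simp add: ballot_def)
qed (simp add: ballot_def binomial_eq_0)

lemma ballot_nonneg: "2 * j \<le> N \<Longrightarrow> ballot N j \<ge> 0"
  using binomial_mono[of "j - 1" j N] by (simp add: ballot_def)

text \<open>The index \<open>p + j\<close> is at least as far from the middle of the row as
  \<open>j\<close>: either both lie beyond it, or the mirror image of \<open>p + j\<close> is at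
  most \<open>j\<close>.\<close>

lemma binomial_add_le: "n \<le> 2 * j + p \<Longrightarrow> n choose (p + j) \<le> n choose j"
proof (cases "p + j \<le> n")
  case True
  assume "n \<le> 2 * j + p"
  show ?thesis
  proof (cases "n div 2 \<le> j")
    case True
    then show ?thesis using binomial_antimono[of j "p + j" n] \<open>p + j \<le> n\<close> by simp
  next
    case False
    have "n choose (p + j) = n choose (n - (p + j))"
      using \<open>p + j \<le> n\<close> by (rule binomial_symmetric)
    also have "\<dots> \<le> n choose j"
      using False \<open>n \<le> 2 * j + p\<close> by (intro binomial_mono) auto
    finally show ?thesis .
  qed
qed (simp add: binomial_eq_0)

section \<open>Signs in the tail\<close>

lemma merge_tail_eq_ballot_gap:
  "merge_tail m p n q j = ballot_gap m n j + int (m choose (q + j)) + int (n choose (p + j))"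
  by (simp add: merge_tail_def ballot_gap_def ballot_def)

text \<open>Past the middle the ballot number is nonpositive, and each shifted binomial is dominated
  by the subtracted unshifted one.\<close>

lemma merge_tail_nonpos:
  assumes "m + n < 2 * j"
  shows "merge_tail m p n q j \<le> 0"
  using ballot_nonpos[OF assms] binomial_add_le[of m j q] binomial_add_le[of n j p] assms
  unfolding merge_tail_eq_ballot_gap ballot_gap_def by linarith

text \<open>
  For \<open>j > m\<close> the tail is \<open>ballot (m + n) j - (n choose j) + (n choose (p + j))\<close>. The quotient
  of \<^term>\<open>ballot (m + n) j\<close> by \<^term>\<open>n choose j\<close> is at least 1 at \<open>j = m\<close>, increases as long as
  \<open>2 j < (m - 1) (m + n + 1 - 2 j)\<close> and decreases afterwards; so once it has dropped below 1 it
  stays there.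
\<close>

lemma ballot_minus_binomial_Suc:
  fixes m n j :: nat
  assumes "j \<ge> 1"
  defines "w \<equiv> int (m + n) + 1 - 2 * int j"
  shows "int (Suc j) * w * (ballot (m + n) (Suc j) - int (n choose Suc j)) =
    (w - 2) * (int (m + n) + 1 - int j) * (ballot (m + n) j - int (n choose j))
    + (w * (int m - 1) - 2 * int j) * int (n choose j)"
proof -
  have "int (Suc j) * w * (ballot (m + n) (Suc j) - int (n choose Suc j)) =
      int (Suc j) * w * ballot (m + n) (Suc j) - w * (int (Suc j) * int (n choose Suc j))"
    by (simp add: algebra_simps)
  also have "\<dots> = (w - 2) * (int (m + n) + 1 - int j) * ballot (m + n) j
      - w * ((int n - int j) * int (n choose j))"
    unfolding w_def using ballot_Suc[OF assms(1), of "m + n"]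
    by (simp only: Suc_times_binomial_Suc) (simp add: algebra_simps)
  also have "\<dots> = (w - 2) * (int (m + n) + 1 - int j) * (ballot (m + n) j - int (n choose j))
    + (w * (int m - 1) - 2 * int j) * int (n choose j)"
    unfolding w_def by (simp add: algebra_simps)
  finally show ?thesis .
qed

text \<open>Induction upwards from \<open>j = m\<close>. The last hypothesis says that the quotient
  is still growing; it gets stronger with \<open>j\<close>, so it is available at all earlier
  indices.\<close>

lemma ballot_gt_binomial:
  assumes "2 \<le> m" "m \<le> n" "m \<le> j" "2 * j < m + n"
    and "2 * int j < (int m - 1) * (int (m + n) + 1 - 2 * int j)"
  shows "int (n choose j) < ballot (m + n) j"
  using assms(3-)
proof (induction j rule: dec_induct)
  case base
  \<comment> \<open>The summand \<open>m choose m = 1\<close> of \<open>ballot_gap\<close> makes the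
    inequality strict.\<close>
  show ?case
    using ballot_gap_nonneg[of m m n] assms by (simp add: ballot_gap_def)
next
  case (step j)
  define w where "w = int (m + n) + 1 - 2 * int j"
  have w: "w > 0" "w \<ge> 2" using step.prems by (auto simp: w_def)
  have "(int m - 1) * (w - 2) \<le> (int m - 1) * w"
    using assms by (intro mult_left_mono) auto
  then have less: "2 * int j < (int m - 1) * w"
    using step.prems by (simp add: w_def algebra_simps)
  have IH: "int (n choose j) < ballot (m + n) j"
    using step.prems less by (intro step.IH) (auto simp: w_def)
  have "0 \<le> (w - 2) * (int (m + n) + 1 - int j) * (ballot (m + n) j - int (n choose j))"
    using w IH step.prems by (intro mult_nonneg_nonneg) auto
  moreover have "0 < (w * (int m - 1) - 2 * int j) * int (n choose j)"
    using less step.prems assms by (intro mult_pos_pos) (auto simp: mult.commute)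
  ultimately have "0 < int (Suc j) * w * (ballot (m + n) (Suc j) - int (n choose Suc j))"
    unfolding w_def using step.hyps assms by (subst ballot_minus_binomial_Suc) auto
  moreover have "0 < int (Suc j) * w"
    using w by simp
  ultimately have "0 < ballot (m + n) (Suc j) - int (n choose Suc j)"
    by (rule zero_less_mult_pos)
  then show ?case by simp
qed

text \<open>A nonpositive entry forces the quotient of the ballot number by
  \<open>n choose j\<close> to be at most 1, hence past its growing phase; the recurrence then
  passes the sign on.\<close>

lemma merge_tail_nonpos_Suc:
  assumes "1 \<le> m" "m \<le> n" "m < j" and nonpos: "merge_tail m p n q j \<le> 0"
  shows "merge_tail m p n q (Suc j) \<le> 0"
proof (cases "m + n < 2 * Suc j")
  case True
  then show ?thesis by (rule merge_tail_nonpos)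
next
  case False
  define w where "w = int (m + n) + 1 - 2 * int j"
  have w: "w \<ge> 3" using False by (simp add: w_def)
  have tail: "merge_tail m p n q i = ballot (m + n) i - int (n choose i) + int (n choose (p + i))" if "m < i" for i
    using that by (simp add: merge_tail_def ballot_def binomial_eq_0)
  have "ballot (m + n) j \<le> int (n choose j)"
    using nonpos tail[of j] assms by simp
  then have past: "(int m - 1) * w \<le> 2 * int j"
    using ballot_gt_binomial[of m n j] assms False unfolding w_def
    by (cases "m = 1") (force simp: not_less)+
  \<comment> \<open>The shifted binomial grows by at most the factor
    \<open>(n - j) / (j + 1)\<close> of the unshifted one, so the difference \<open>K\<close> of
    both can replace \<open>n choose j\<close> in the recurrence.\<close>
  have le: "int (Suc j) * int (n choose (p + Suc j)) \<le> (int n - int j) * int (n choose (p + j))"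
  proof (cases "p + j \<le> n")
    case True
    have "int (Suc j) * int (n choose (p + Suc j)) \<le> int (Suc (p + j)) * int (n choose Suc (p + j))"
      by (simp add: mult_right_mono)
    also have "\<dots> \<le> (int n - int j) * int (n choose (p + j))"
      unfolding Suc_times_binomial_Suc by (intro mult_right_mono) auto
    finally show ?thesis .
  qed (simp add: binomial_eq_0)
  define K where "K = int (n choose j) - int (n choose (p + j))"
  have K: "0 \<le> ballot (m + n) j" "ballot (m + n) j \<le> K"
    using nonpos tail[of j] assms ballot_nonneg[of j "m + n"] False by (auto simp: K_def)
  have "int (Suc j) * w * merge_tail m p n q (Suc j) =
      int (Suc j) * w * (ballot (m + n) (Suc j) - int (n choose Suc j))
      + w * (int (Suc j) * int (n choose (p + Suc j)))"
    by (subst tail) (use assms in \<open>simp_all add: algebra_simps\<close>)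
  also have "\<dots> \<le> int (Suc j) * w * (ballot (m + n) (Suc j) - int (n choose Suc j))
      + w * ((int n - int j) * int (n choose (p + j)))"
    using le w by (intro add_left_mono mult_left_mono) auto
  also have "int (Suc j) * w * (ballot (m + n) (Suc j) - int (n choose Suc j)) =
    (w - 2) * (int (m + n) + 1 - int j) * (ballot (m + n) j - int (n choose j))
    + (w * (int m - 1) - 2 * int j) * int (n choose j)"
    unfolding w_def using assms by (intro ballot_minus_binomial_Suc) auto
  also have "(w - 2) * (int (m + n) + 1 - int j) * (ballot (m + n) j - int (n choose j))
      + (w * (int m - 1) - 2 * int j) * int (n choose j) + w * ((int n - int j) * int (n choose (p + j)))
    = (w - 2) * (int (m + n) + 1 - int j) * (ballot (m + n) j - K) + (w * (int m - 1) - 2 * int j) * K"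
    unfolding K_def w_def by (simp add: algebra_simps)
  also have "\<dots> \<le> 0"
  proof (rule add_nonpos_nonpos)
    show "(w - 2) * (int (m + n) + 1 - int j) * (ballot (m + n) j - K) \<le> 0"
      using w K False by (intro mult_nonneg_nonpos mult_nonneg_nonneg) auto
    show "(w * (int m - 1) - 2 * int j) * K \<le> 0"
      using past K by (intro mult_nonpos_nonneg) (auto simp: mult.commute)
  qed
  finally show ?thesis
    using w by (simp add: mult_le_0_iff)
qed

section \<open>A single sign change of the differences\<close>

definition sign_change_at :: "(nat \<Rightarrow> int) \<Rightarrow> nat \<Rightarrow> bool" where
  "sign_change_at f t \<longleftrightarrow> (\<forall>i. 1 \<le> i \<and> i \<le> t \<longrightarrow> 0 \<le> f i) \<and> (\<forall>i>t. f i \<le> 0)"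

text \<open>The first negative entry is not at index 1, so by \<open>ballot_gap_nonneg\<close> it
  lies beyond \<open>m\<close>; from there on \<open>merge_tail_nonpos_Suc\<close> keeps all entries
  nonpositive.\<close>

lemma merge_tail_sign_change:
  assumes "1 \<le> m" "m \<le> n" "merge_tail m p n q 1 \<ge> 0"
  shows "\<exists>t. sign_change_at (merge_tail m p n q) t"
proof (cases "\<exists>j\<ge>1. merge_tail m p n q j < 0")
  case True
  define j where "j = (LEAST j. 1 \<le> j \<and> merge_tail m p n q j < 0)"
  have j: "1 \<le> j" "merge_tail m p n q j < 0"
    using True unfolding j_def by (metis (mono_tags, lifting) LeastI_ex)+
  have before: "merge_tail m p n q i \<ge> 0" if "1 \<le> i" "i < j" for i
    using that not_less_Least[of i "\<lambda>j. 1 \<le> j \<and> merge_tail m p n q j < 0"] by (auto simp: j_def not_less)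
  have "j \<noteq> 1" using assms j by auto
  have "m < j"
  proof (rule ccontr)
    assume "\<not> m < j"
    then have "ballot_gap m n j \<ge> 0"
      using assms j \<open>j \<noteq> 1\<close> by (intro ballot_gap_nonneg) auto
    then show False
      using j by (simp add: merge_tail_eq_ballot_gap)
  qed
  have "merge_tail m p n q i \<le> 0" if "j \<le> i" for i
    using that
  proof (induction i rule: dec_induct)
    case (step i)
    then show ?case
      using merge_tail_nonpos_Suc[of m n i p q] assms \<open>m < j\<close> by simp
  qed (use j in simp)
  then show ?thesis
    using before j unfolding sign_change_at_def by (intro exI[of _ "j - 1"]) auto
next
  case False
  then show ?thesis
    unfolding sign_change_at_def using merge_tail_nonpos[of m n]
    by (intro exI[of _ "m + n"]) (auto simp: not_less)
qed

text \<open>The negative contribution is at most a single -1, from the interval before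
  \<open>p + q\<close> or from the correction at \<open>p + q\<close>. If \<open>p < n\<close>, it
  is offset by the indicator of \<open>i < q\<close> or else by \<open>n choose (i - q)\<close>; the
  other case is symmetric.\<close>

lemma merge_diff_head_nonneg:
  assumes "p < n \<or> q < m" "i \<le> p + q"
  shows "merge_diff m p n q i \<ge> 0"
proof -
  have *: "merge_diff m p n q i \<ge> 0" if "p < n" "i \<le> p + q" for m p n q
  proof -
    have pos: "q \<le> i \<Longrightarrow> int (n choose (i - q)) \<ge> 1"
      using that by (simp add: Suc_le_eq)
    have "i = p + q \<Longrightarrow> int (m choose q) + int (n choose p) \<ge> 1"
      using pos by simp
    then show ?thesis
      using that pos by (auto simp: merge_diff_eq)
  qed
  from assms(1) show ?thesis
  proof
    assume "q < m"
    then show ?thesis using *[of q m p n] assms(2) by (subst merge_diff_commute) (simp add: add.commute)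
  qed (use * assms in blast)
qed

lemma merge_tail_1: "merge_tail m p n q 1 = -1 + int (m choose (q + 1)) + int (n choose (p + 1))"
  by (simp add: merge_tail_def)

text \<open>The tail starts with a nonnegative entry because one of its shifted binomials is
  positive; its sign change then serves for the whole sequence, whose head is nonnegative.\<close>

lemma merge_diff_sign_change_easy:
  assumes "p < n \<or> q < m" "1 \<le> m" "m \<le> n"
  shows "\<exists>t. sign_change_at (merge_diff m p n q) t"
proof -
  have "merge_tail m p n q 1 \<ge> 0"
  proof -
    have "m choose (q + 1) \<ge> 1 \<or> n choose (p + 1) \<ge> 1"
      using assms(1) by (auto simp: Suc_le_eq)
    then show ?thesis unfolding merge_tail_1 by linarith
  qed
  then obtain t where t: "sign_change_at (merge_tail m p n q) t"
    using merge_tail_sign_change assms by blast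
  have "sign_change_at (merge_diff m p n q) (p + q + t)"
    unfolding sign_change_at_def
  proof safe
    fix i assume i: "1 \<le> i" "i \<le> p + q + t"
    show "0 \<le> merge_diff m p n q i"
    proof (cases "i \<le> p + q")
      case False
      then obtain j where "i = p + q + j" "j > 0"
        by (metis le_add1 less_imp_add_positive not_le)
      then show ?thesis using t i by (simp add: merge_diff_tail sign_change_at_def)
    qed (use merge_diff_head_nonneg assms in blast)
  next
    fix i assume i: "p + q + t < i"
    then obtain j where "i = p + q + j" "j > t"
      by (metis add.assoc less_imp_add_positive less_add_same_cancel1 )
    then show "merge_diff m p n q i \<le> 0" using t by (simp add: merge_diff_tail sign_change_at_def)
  qed
  then show ?thesis ..
qed

text \<open>The shifted binomials vanish, leaving \<open>ballot_gap\<close>. For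
  \<open>m = 1\<close> Pascal's rule shows its sign; for \<open>m = n = 2\<close> only
  \<open>j = 1\<close> and \<open>j = 2\<close> are not past the middle, and these are
  evaluated.\<close>

lemma merge_tail_nonpos_small:
  assumes "n \<le> p" "m \<le> q" "m = 1 \<or> m = 2 \<and> n = 2" "j > 0"
  shows "merge_tail m p n q j \<le> 0"
proof -
  have tail: "merge_tail m p n q j = ballot_gap m n j"
    using assms by (simp add: merge_tail_eq_ballot_gap binomial_eq_0)
  show ?thesis
  proof (cases "m = 1")
    case True
    obtain i where i: "j = Suc i" using assms(4) gr0_implies_Suc by blast
    have "ballot_gap 1 n (Suc i) \<le> 0"
      by (cases i) (auto simp: ballot_gap_def ballot_def binomial_eq_0)
    then show ?thesis
      using tail i True by simp
  next
    case False
    then have [simp]: "m = 2" "n = 2" using assms by auto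
    have small: "ballot_gap 2 2 1 \<le> 0" "ballot_gap 2 2 2 \<le> 0"
      by (simp_all add: ballot_gap_def ballot_def eval_nat_numeral)
    consider "j = 1" | "j = 2" | "4 < 2 * j" using assms(4) by linarith
    then show ?thesis
    proof cases
      case 3
      then show ?thesis using merge_tail_nonpos[of m n] by simp
    qed (use tail small in simp_all)
  qed
qed

lemma merge_diff_sign_change_small:
  assumes "n \<le> p" "m \<le> q" "m = 1 \<or> m = 2 \<and> n = 2" "1 \<le> n"
  shows "\<exists>t. sign_change_at (merge_diff m p n q) t"
proof -
  \<comment> \<open>This is the last index, at most \<open>p + q\<close>, at which one of the
    shifted binomial rows is still positive and offsets the -1.\<close>
  have "sign_change_at (merge_diff m p n q) (max (p + m) (q + n))"
    unfolding sign_change_at_def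
  proof safe
    fix i assume i: "1 \<le> i" "i \<le> max (p + m) (q + n)"
    have "i - p \<le> m \<or> i - q \<le> n" using i by auto
    then have "0 < (m choose (i - p)) \<or> 0 < (n choose (i - q))"
      by simp
    then have *: "int (m choose (i - p)) + int (n choose (i - q)) \<ge> 1"
      by linarith
    show "0 \<le> merge_diff m p n q i"
      using i assms * by (auto simp: merge_diff_eq)
  next
    fix i assume i: "max (p + m) (q + n) < i"
    show "merge_diff m p n q i \<le> 0"
    proof (cases "i \<le> p + q")
      case False
      then obtain j where "i = p + q + j" "j > 0"
        by (metis less_imp_add_positive not_le)
      then show ?thesis using merge_tail_nonpos_small assms by (simp add: merge_diff_tail)
    next
      case True
      then show ?thesis using i assms by (auto simp: merge_diff_eq binomial_eq_0)
    qed
  qed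
  then show ?thesis ..
qed

text \<open>A fall at \<open>p + q + 1\<close> is followed by a rise at \<open>p + q + 2\<close>;
  the rise needs \<open>(m - 1) * (n - 1) > 1\<close>, which excludes
  \<open>m = n = 2\<close>.\<close>

lemma merge_diff_not_sign_change:
  assumes "2 \<le> m" "2 \<le> n" "n \<le> p" "m \<le> q" "5 \<le> m + n"
  shows "\<not> sign_change_at (merge_diff m p n q) t"
proof
  assume t: "sign_change_at (merge_diff m p n q) t"
  have "merge_diff m p n q (p + q + 1) = -1"
    using assms by (subst merge_diff_tail) (simp_all add: merge_tail_def binomial_eq_0)
  then have "t < p + q + 1"
    using t unfolding sign_change_at_def by (smt (verit) le_add2 not_le)
  then have "merge_diff m p n q (p + q + 2) \<le> 0"
    using t unfolding sign_change_at_def by simp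
  moreover have "merge_diff m p n q (p + q + 2) = (int m - 1) * (int n - 1) - 1"
  proof -
    have c2: "2 * int (k choose 2) = int k * (int k - 1)" for k
      using Suc_times_binomial_Suc[of 1 k] by (simp add: numeral_2_eq_2 mult.commute)
    have "2 * merge_diff m p n q (p + q + 2) = 2 * ((int m - 1) * (int n - 1) - 1)"
      using assms c2[of m] c2[of n] c2[of "m + n"]
      by (subst merge_diff_tail) (simp_all add: merge_tail_def binomial_eq_0 algebra_simps)
    then show ?thesis by simp
  qed
  moreover have "(int m - 1) * (int n - 1) > 1"
  proof -
    have "2 * 1 \<le> (int m - 1) * (int n - 1) \<or> 1 * 2 \<le> (int m - 1) * (int n - 1)"
    proof (cases "m \<ge> 3")
      case True
      then have "2 * 1 \<le> (int m - 1) * (int n - 1)" using assms by (intro mult_mono) auto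
      then show ?thesis ..
    next
      case False
      then have "1 * 2 \<le> (int m - 1) * (int n - 1)" using assms by (intro mult_mono) auto
      then show ?thesis ..
    qed
    then show ?thesis by linarith
  qed
  ultimately show False by linarith
qed

lemma merge_diff_sign_change_iff:
  assumes "1 \<le> m" "1 \<le> n"
  shows "(\<exists>t. sign_change_at (merge_diff m p n q) t) \<longleftrightarrow>
    \<not> (2 \<le> m \<and> 2 \<le> n \<and> n \<le> p \<and> m \<le> q \<and> 5 \<le> m + n)"
proof (cases "2 \<le> m \<and> 2 \<le> n \<and> n \<le> p \<and> m \<le> q \<and> 5 \<le> m + n")
  case True
  then show ?thesis using merge_diff_not_sign_change by blast
next
  case False
  have "\<exists>t. sign_change_at (merge_diff m p n q) t"
    if "\<not> (2 \<le> m \<and> 2 \<le> n \<and> n \<le> p \<and> m \<le> q \<and> 5 \<le> m + n)" "1 \<le> m" "m \<le> n" for m p n q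
  proof (cases "p < n \<or> q < m")
    case False
    then have "m = 1 \<or> m = 2 \<and> n = 2" using that by auto
    then show ?thesis using False that by (intro merge_diff_sign_change_small) auto
  qed (use that merge_diff_sign_change_easy in blast)
  from this[of m n p q] this[of n m q p] show ?thesis
    using assms False merge_diff_commute[of m p n q]
    by (metis add.commute linorder_le_cases)
qed

section \<open>Counting unordered pairs of brooms\<close>

text \<open>Double counting over the sets \<open>{a, b}\<close>: each contributes 2, either by two
  ordered pairs or by one ordered pair and one diagonal element.\<close>

lemma card_unordered_pairs:
  assumes "finite R" "sym R"
  shows "2 * card ((\<lambda>(a, b). {a, b}) ` R) = card R + card {a. (a, a) \<in> R}"
proof -
  define f :: "'a \<times> 'a \<Rightarrow> 'a set" where "f = (\<lambda>(a, b). {a, b})"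
  define D where "D = {a. (a, a) \<in> R}"
  have finD: "finite D"
    by (rule finite_subset[of D "fst ` R"]) (use assms(1) in \<open>force simp: D_def\<close>)+
  have "(\<Sum>s\<in>f ` R. card {x \<in> R. f x = s} + card {a \<in> D. {a} = s}) = (\<Sum>s\<in>f ` R. 2)"
  proof (rule sum.cong)
    fix s assume "s \<in> f ` R"
    then obtain a b where ab: "(a, b) \<in> R" "s = {a, b}" by (auto simp: f_def)
    then have ba: "(b, a) \<in> R" using assms(2) by (auto dest: symD)
    show "card {x \<in> R. f x = s} + card {a \<in> D. {a} = s} = 2"
    proof (cases "a = b")
      case True
      then have "{x \<in> R. f x = s} = {(a, a)}" "{a \<in> D. {a} = s} = {a}"
        using ab by (auto simp: f_def D_def)
      then show ?thesis by simp
    next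
      case False
      then have fibres: "{x \<in> R. f x = s} = {(a, b), (b, a)}" "{a \<in> D. {a} = s} = {}"
        using ab ba by (auto simp: f_def doubleton_eq_iff)
      show ?thesis unfolding fibres using False by simp
    qed
  qed simp
  moreover have "card R = (\<Sum>s\<in>f ` R. card {x \<in> R. f x = s})"
    using sum.image_gen[OF assms(1), of "\<lambda>_. 1::nat" f] by simp
  moreover have "card D = (\<Sum>s\<in>f ` R. card {a \<in> D. {a} = s})"
  proof -
    have "(\<lambda>a. {a}) ` D \<subseteq> f ` R" by (force simp: D_def f_def)
    then show ?thesis
      using sum.group[OF finD, of "f ` R" "\<lambda>a. {a}" "\<lambda>_. 1::nat"] assms(1) by simp
  qed
  ultimately show ?thesis
    by (simp add: sum.distrib f_def D_def)
qed

text \<open>A pair \<open>(p, m)\<close> stands for the broom \<open>B\<^sub>m\<^sub>,\<^sub>p\<close>.\<close>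

definition non_unimodal_pairs :: "nat \<Rightarrow> ((nat \<times> nat) \<times> (nat \<times> nat)) set" where
  "non_unimodal_pairs i = {((p, m), (q, n)) | p m q n.
     2 \<le> m \<and> 2 \<le> n \<and> n \<le> p \<and> m \<le> q \<and> 5 \<le> m + n \<and> Suc (p + m + (q + n)) = i}"

lemma sym_non_unimodal_pairs: "sym (non_unimodal_pairs i)"
  by (auto simp: sym_def non_unimodal_pairs_def)

lemma finite_non_unimodal_pairs: "finite (non_unimodal_pairs i)"
  by (rule finite_subset[of _ "({..i} \<times> {..i}) \<times> ({..i} \<times> {..i})"]) (auto simp: non_unimodal_pairs_def)

text \<open>The constraints even give \<open>i \<ge> 1 + 2 * (m + n) \<ge> 11\<close>; the value at
  10 is left to the even formula with \<open>k = 0\<close>.\<close>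

lemma non_unimodal_pairs_empty: "i \<le> 9 \<Longrightarrow> non_unimodal_pairs i = {}"
  by (auto simp: non_unimodal_pairs_def)

text \<open>Parametrisation by \<open>s = m + n - 4\<close>, \<open>a = m - 2\<close> and
  \<open>c = p - n\<close>. The excesses \<open>p - n\<close> and \<open>q - m\<close> add up to
  \<open>L - 2 * s\<close>, so there are \<open>s + 1\<close> choices of \<open>a\<close> and
  \<open>L - 2 * s + 1\<close> of \<open>c\<close>.\<close>

lemma card_non_unimodal_pairs:
  "card (non_unimodal_pairs (L + 9)) = (\<Sum>s\<in>{s. 1 \<le> s \<and> 2 * s \<le> L}. (s + 1) * (L - 2 * s + 1))"
proof -
  define S where "S = (SIGMA s:{s. 1 \<le> s \<and> 2 * s \<le> L}. {..s} \<times> {..L - 2 * s})"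
  define g :: "nat \<times> nat \<times> nat \<Rightarrow> (nat \<times> nat) \<times> (nat \<times> nat)" where
    "g = (\<lambda>(s, a, c). ((s - a + 2 + c, a + 2), (a + 2 + (L - 2 * s - c), s - a + 2)))"
  define h :: "(nat \<times> nat) \<times> (nat \<times> nat) \<Rightarrow> nat \<times> nat \<times> nat" where
    "h = (\<lambda>((p, m), (q, n)). (m + n - 4, m - 2, p - n))"
  have "bij_betw g S (non_unimodal_pairs (L + 9))"
    by (rule bij_betw_byWitness[where f' = h]) (auto simp: g_def h_def S_def non_unimodal_pairs_def)
  then have "card (non_unimodal_pairs (L + 9)) = card S"
    by (simp add: bij_betw_same_card)
  also have "\<dots> = (\<Sum>s\<in>{s. 1 \<le> s \<and> 2 * s \<le> L}. card ({..s} \<times> {..L - 2 * s}))"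
    unfolding S_def
    by (rule card_SigmaI) (auto intro: finite_subset[of _ "{..L}"])
  finally show ?thesis by (simp add: card_cartesian_product)
qed

section \<open>Closed forms of the counts\<close>

lemma sum_Suc_times_diff:
  "6 * (\<Sum>s=1..k. (int s + 1) * (x - int s)) = 3 * x * int k * (int k + 3) - 2 * int k * (int k + 1) * (int k + 2)"
  by (induction k) (simp_all add: algebra_simps)

lemma card_non_unimodal_pairs_even: "6 * int (card (non_unimodal_pairs (2 * k + 10))) = 2 * int k * (int k + 1) * (int k + 5)"
proof -
  have "{s. 1 \<le> s \<and> 2 * s \<le> 2 * k + 1} = {1..k}" by auto
  then have "int (card (non_unimodal_pairs (2 * k + 10))) = (\<Sum>s=1..k. int ((s + 1) * (2 * k + 1 - 2 * s + 1)))"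
    using card_non_unimodal_pairs[of "2 * k + 1"] by (simp only: add.assoc) simp
  also have "\<dots> = 2 * (\<Sum>s=1..k. (int s + 1) * (int k + 1 - int s))"
    unfolding sum_distrib_left
  proof (rule sum.cong)
    fix s assume "s \<in> {1..k}"
    then obtain d where "k = s + d" by (auto simp: le_iff_add)
    then show "int ((s + 1) * (2 * k + 1 - 2 * s + 1)) = 2 * ((int s + 1) * (int k + 1 - int s))"
      by (simp add: algebra_simps)
  qed simp
  finally show ?thesis
    using sum_Suc_times_diff[of "int k + 1" k] by (simp add: algebra_simps)
qed

lemma card_non_unimodal_pairs_odd:
  "6 * int (card (non_unimodal_pairs (2 * k + 11))) = (int k + 1) * (2 * int k * (int k + 5) + 3 * (int k + 4))"
proof -
  have "{s. 1 \<le> s \<and> 2 * s \<le> 2 * k + 2} = {1..k + 1}" by auto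
  then have "int (card (non_unimodal_pairs (2 * k + 11))) = (\<Sum>s=1..k + 1. int ((s + 1) * (2 * k + 2 - 2 * s + 1)))"
    using card_non_unimodal_pairs[of "2 * k + 2"] by (simp only: add.assoc) simp
  also have "\<dots> = (\<Sum>s=1..k + 1. 2 * ((int s + 1) * (int k + 1 - int s)) + (int s + 1))"
  proof (rule sum.cong)
    fix s assume "s \<in> {1..k + 1}"
    then obtain d where "k + 1 = s + d" by (metis atLeastAtMost_iff le_iff_add)
    then have "2 * k + 2 - 2 * s = 2 * d" "int k = int s + int d - 1" by linarith+
    then show "int ((s + 1) * (2 * k + 2 - 2 * s + 1)) = 2 * ((int s + 1) * (int k + 1 - int s)) + (int s + 1)"
      by (simp add: algebra_simps)
  qed simp
  also have "\<dots> = 2 * (\<Sum>s=1..k + 1. (int s + 1) * (int k + 1 - int s)) + (\<Sum>s=1..k + 1. int s + 1)"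
    by (simp only: sum.distrib sum_distrib_left)
  finally have "6 * int (card (non_unimodal_pairs (2 * k + 11))) =
     2 * (6 * (\<Sum>s=1..k + 1. (int s + 1) * (int k + 1 - int s))) + 6 * (\<Sum>s=1..k + 1. int s + 1)"
    by simp
  moreover have "2 * (\<Sum>s=1..j. int s + 1) = int j * (int j + 3)" for j
    by (induction j) (simp_all add: algebra_simps)
  from this[of "k + 1"] have "6 * (\<Sum>s=1..k + 1. int s + 1) = 3 * ((int k + 1) * (int k + 4))"
    by (simp add: algebra_simps)
  ultimately show ?thesis
    unfolding sum_Suc_times_diff by (simp add: algebra_simps)
qed

text \<open>Two equal brooms give \<open>2 * (p + m) + 1\<close> vertices, an odd number.\<close>

lemma diagonal_non_unimodal_pairs_even: "{a. (a, a) \<in> non_unimodal_pairs (2 * k + 10)} = {}"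
  by (auto simp: non_unimodal_pairs_def) presburger

lemma card_diagonal_non_unimodal_pairs_odd: "card {a. (a, a) \<in> non_unimodal_pairs (2 * k + 11)} = (k + 1) div 2"
proof -
  \<comment> \<open>On the diagonal \<open>p + m = k + 5\<close> and \<open>m \<le> p\<close>, while
    \<open>5 \<le> m + m\<close> raises the lower bound to 3.\<close>
  have "bij_betw (\<lambda>m. (k + 5 - m, m)) {3..(k + 5) div 2} {a. (a, a) \<in> non_unimodal_pairs (2 * k + 11)}"
    by (rule bij_betw_byWitness[where f' = snd]) (auto simp: non_unimodal_pairs_def)
  then have "card {a. (a, a) \<in> non_unimodal_pairs (2 * k + 11)} = card {3..(k + 5) div 2}"
    by (rule bij_betw_same_card[symmetric])
  also have "\<dots> = (k + 1) div 2"
    using div_add_self2[of 2 "k + 3"] div_add_self2[of 2 "k + 1"] by simp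
  finally show ?thesis .
qed

lemma floor_quarter: "\<lfloor>real a / 4\<rfloor> = int (a div 4)"
  using floor_divide_of_nat_eq[of a 4] by simp

text \<open>Writing \<open>k = 2 * h + r\<close> with \<open>r\<close> the parity gives
  \<open>k\<^sup>2 = 4 * h * (h + r) + r\<close>, which trades the division by 4 for a case split on
  parity.\<close>

lemma quarter_square:
  "k\<^sup>2 div 4 = (k div 2) * (k div 2 + k mod 2)"
  "k * (k + 4) div 4 = (k div 2) * (k div 2 + k mod 2) + k" for k :: nat
proof -
  have sq: "k\<^sup>2 = 4 * ((k div 2) * (k div 2 + k mod 2)) + k mod 2"
    by (cases "even k") (auto elim!: evenE oddE simp: power2_eq_square algebra_simps mod_Suc)
  have div: "(4 * x + k mod 2) div 4 = x" for x
    by simp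
  show "k\<^sup>2 div 4 = (k div 2) * (k div 2 + k mod 2)"
    by (subst sq) (rule div)
  have "k * (k + 4) = 4 * ((k div 2) * (k div 2 + k mod 2) + k) + k mod 2"
    using sq by (simp add: algebra_simps power2_eq_square)
  then show "k * (k + 4) div 4 = (k div 2) * (k div 2 + k mod 2) + k"
    by (simp only: div)
qed

text \<open>Links the floor sums of the claim to the cubic polynomial that counts ordered
  pairs.\<close>

lemma sum_quarter:
  "6 * (2 * (\<Sum>i=0..k. int (i * (i + 4) div 4)) - int (k\<^sup>2 div 4)) = int k * (int k + 1) * (int k + 5)"
proof (induction k)
  case (Suc k)
  obtain r where "k = 2 * r \<or> k = 2 * r + 1" by (metis oddE evenE)
  then show ?case
    using Suc unfolding quarter_square
    by (auto simp: algebra_simps quarter_square Suc_double_not_eq_double)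
qed simp

lemma card_unordered_non_unimodal_even:
  "int (card ((\<lambda>(a, b). {a, b}) ` non_unimodal_pairs (2 * k + 10))) =
     2 * (\<Sum>i=0..k. \<lfloor>real (i * (i + 4)) / 4\<rfloor>) - \<lfloor>real (k\<^sup>2) / 4\<rfloor>"
  using card_unordered_pairs[OF finite_non_unimodal_pairs sym_non_unimodal_pairs, of "2 * k + 10"]
    card_non_unimodal_pairs_even[of k] sum_quarter[of k]
  unfolding floor_quarter diagonal_non_unimodal_pairs_even by simp

lemma card_unordered_non_unimodal_odd:
  "int (card ((\<lambda>(a, b). {a, b}) ` non_unimodal_pairs (2 * k + 11))) =
     2 * (\<Sum>i=0..k. \<lfloor>real (i * (i + 4)) / 4\<rfloor>) + \<lfloor>real ((k + 1) * (k + 5)) / 4\<rfloor>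
       - \<lfloor>real (k\<^sup>2) / 4\<rfloor>"
proof -
  have "2 * int (card ((\<lambda>(a, b). {a, b}) ` non_unimodal_pairs (2 * k + 11))) =
      int (card (non_unimodal_pairs (2 * k + 11))) + int ((k + 1) div 2)"
    using card_unordered_pairs[OF finite_non_unimodal_pairs sym_non_unimodal_pairs, of "2 * k + 11"]
    unfolding card_diagonal_non_unimodal_pairs_odd by linarith
  moreover have "6 * int (card (non_unimodal_pairs (2 * k + 11))) =
      2 * (int k * (int k + 1) * (int k + 5)) + 3 * ((int k + 1) * (int k + 4))"
    unfolding card_non_unimodal_pairs_odd by (simp add: algebra_simps)
  \<comment> \<open>The diagonal term completes the quadratic part of the ordered count to the
    single floor of the claim.\<close>
  moreover have "(int k + 1) * (int k + 4) + 2 * int ((k + 1) div 2) = 4 * int ((k + 1) * (k + 5) div 4)"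
  proof -
    obtain r where "k = 2 * r \<or> k = 2 * r + 1" by (metis oddE evenE)
    then show ?thesis
      using quarter_square(2)[of "k + 1"] by (auto simp: algebra_simps)
  qed
  \<comment> \<open>Abstracting the nonlinear terms to variables leaves a linear problem.\<close>
  moreover have "b = 2 * S + F - sq"
    if "2 * b = c + e" "6 * c = 2 * P + 3 * Q" "Q + 2 * e = 4 * F" "6 * (2 * S - sq) = P"
    for b c e F P Q S sq :: int
    using that by presburger
  ultimately show ?thesis
    using sum_quarter[of k] unfolding floor_quarter by blast
qed

section \<open>Arborescences and their isomorphisms\<close>

text \<open>Rooted trees described by parents instead of unique walks, a form that is easily checked
  for brooms and merges and carried along isomorphisms.\<close>

definition arborescence :: "'a rooted_digraph \<Rightarrow> bool" where
  "arborescence T \<longleftrightarrow> finite (rverts T) \<and> rarcs T \<subseteq> rverts T \<times> rverts T \<and> root_of T \<in> rverts T \<and>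
     (\<forall>u. (u, root_of T) \<notin> rarcs T) \<and>
     (\<forall>u u' v. (u, v) \<in> rarcs T \<longrightarrow> (u', v) \<in> rarcs T \<longrightarrow> u = u') \<and>
     (\<forall>v\<in>rverts T. (root_of T, v) \<in> (rarcs T)\<^sup>*)"

lemma arborescenceD:
  assumes "arborescence T"
  shows arborescence_finite: "finite (rverts T)"
    and arborescence_arcs: "(u, v) \<in> rarcs T \<Longrightarrow> u \<in> rverts T" "(u, v) \<in> rarcs T \<Longrightarrow> v \<in> rverts T"
    and arborescence_arcs_subset: "rarcs T \<subseteq> rverts T \<times> rverts T"
    and arborescence_root: "root_of T \<in> rverts T"
    and arborescence_no_arc_to_root: "(u, root_of T) \<notin> rarcs T"
    and arborescence_parent_unique: "(u, v) \<in> rarcs T \<Longrightarrow> (u', v) \<in> rarcs T \<Longrightarrow> u = u'"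
    and arborescence_reachable: "v \<in> rverts T \<Longrightarrow> (root_of T, v) \<in> (rarcs T)\<^sup>*"
  using assms unfolding arborescence_def by blast+

lemma pcas_append: "pcas u (p @ q) w \<longleftrightarrow> (\<exists>v. pcas u p v \<and> pcas v q w)"
  by (induction p arbitrary: u) auto

lemma wf_digraph_rdigraph_iff: "wf_digraph (rdigraph T) \<longleftrightarrow> rarcs T \<subseteq> rverts T \<times> rverts T"
  unfolding wf_digraph_def by force

lemma fin_digraph_rdigraph:
  assumes "arborescence T"
  shows "fin_digraph (rdigraph T)"
proof -
  have "finite (rarcs T)"
    using assms finite_subset[OF arborescence_arcs_subset] arborescence_finite by blast
  then show ?thesis
    using assms
    by (simp add: fin_digraph_def fin_digraph_axioms_def wf_digraph_rdigraph_iff arborescence_def)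
qed

text \<open>Uniqueness of walks comes from peeling off last arcs: the parent is unique, and no
  nonempty walk ends in the root.\<close>

lemma rooted_tree_if_arborescence:
  assumes "arborescence T"
  shows "rooted_tree T"
proof -
  let ?r = "root_of T" and ?E = "rarcs T"
  have awalk: "pre_digraph.awalk (rdigraph T) ?r p v \<longleftrightarrow> set p \<subseteq> ?E \<and> pcas ?r p v" for p v
    using arborescence_root[OF assms] by (simp add: pre_digraph.awalk_def cas_with_proj_eq)
  have ex: "\<exists>p. set p \<subseteq> ?E \<and> pcas ?r p v" if "(?r, v) \<in> ?E\<^sup>*" for v
    using that
  proof induction
    case base
    then show ?case by (intro exI[of _ "[]"]) simp
  next
    case (step v w)
    then obtain p where "set p \<subseteq> ?E" "pcas ?r p v" by blast
    with step.hyps show ?case by (intro exI[of _ "p @ [(v, w)]"]) (auto simp: pcas_append)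
  qed
  have uniq: "p = q"
    if "set p \<subseteq> ?E" "pcas ?r p v" "set q \<subseteq> ?E" "pcas ?r q v" for p q v
    using that
  proof (induction p arbitrary: q v rule: rev_induct)
    case Nil
    then show ?case
      using arborescence_no_arc_to_root[OF assms] by (cases q rule: rev_cases) (auto simp: pcas_append)
  next
    case (snoc e p)
    obtain q' e' where q: "q = q' @ [e']"
      using snoc.prems arborescence_no_arc_to_root[OF assms]
      by (cases q rule: rev_cases; cases e) (auto simp: pcas_append)
    have "e' = e"
      using snoc.prems arborescence_parent_unique[OF assms, of "fst e" "snd e" "fst e'"]
      by (cases e; cases e') (auto simp: q pcas_append)
    then show ?case
      using snoc.prems snoc.IH[of "fst e" q'] by (auto simp: q pcas_append)
  qed
  show ?thesis
    unfolding rooted_tree_def awalk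
    using fin_digraph_rdigraph[OF assms] arborescence_root[OF assms]
      ex[OF arborescence_reachable[OF assms]] uniq by blast
qed

section \<open>Root subtrees as parent-closed vertex sets\<close>

definition root_closed_sets :: "'a rooted_digraph \<Rightarrow> 'a set set" where
  "root_closed_sets T =
     {S. S \<subseteq> rverts T \<and> root_of T \<in> S \<and> (\<forall>u v. (u, v) \<in> rarcs T \<longrightarrow> v \<in> S \<longrightarrow> u \<in> S)}"

text \<open>If the parent \<open>u\<close> of \<open>v\<close> were missing, an undirected walk
  inside \<open>S\<close> from \<open>v\<close> could never leave the descendants of
  \<open>v\<close>; but connectedness leads it to the root, which has no incoming arc.\<close>

lemma root_closed_if_connected:
  assumes "arborescence T" "root_of T \<in> S" "Digraph_Component.connected (rdigraph T \<restriction> S)"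
    "(u, v) \<in> rarcs T" "v \<in> S"
  shows "u \<in> S"
proof (rule ccontr)
  assume u: "u \<notin> S"
  let ?F = "parcs (mk_symmetric (rdigraph T \<restriction> S))"
  have "(v, root_of T) \<in> rtrancl_on S ?F"
    using assms unfolding connected_def strongly_connected_def reachable_def
    by (auto simp: mk_symmetric_def)
  then have "v \<in> S \<longrightarrow> (v, root_of T) \<in> (rarcs T)\<^sup>*"
    using u assms(4)
  proof (induction rule: rtrancl_on.induct)
    case (rtrancl_on_into_rtrancl_on v x y)
    show ?case
    proof
      assume "v \<in> S"
      then have vx: "(v, x) \<in> (rarcs T)\<^sup>*"
        using rtrancl_on_into_rtrancl_on by blast
      have "(x, y) \<in> rarcs T \<or> (y, x) \<in> rarcs T \<and> y \<in> S"
        using rtrancl_on_into_rtrancl_on by (auto simp: mk_symmetric_def)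
      then show "(v, y) \<in> (rarcs T)\<^sup>*"
      proof
        \<comment> \<open>A step to the parent: from \<open>v\<close> it would lead to
          \<open>u\<close>, outside \<open>S\<close>; below \<open>v\<close> the parent
          \<open>y\<close> is the predecessor of \<open>x\<close> on the path from
          \<open>v\<close>.\<close>
        assume yx: "(y, x) \<in> rarcs T \<and> y \<in> S"
        from vx show ?thesis
        proof (cases rule: rtranclE)
          case base
          then show ?thesis
            using yx rtrancl_on_into_rtrancl_on.prems arborescence_parent_unique[OF assms(1)] by blast
        next
          case (step z)
          then show ?thesis
            using yx arborescence_parent_unique[OF assms(1), of z x y] by blast
        qed
      qed (use vx in auto)
    qed
  qed auto
  then have "(v, root_of T) \<in> (rarcs T)\<^sup>*" using assms by blast
  then show False
    using arborescence_no_arc_to_root[OF assms(1)] assms(4) by (auto elim: rtranclE)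
qed

text \<open>The directed path from the root to a vertex of \<open>S\<close> stays in
  \<open>S\<close>, so every vertex is joined to the root in both directions of the symmetric
  closure.\<close>

lemma connected_if_root_closed:
  assumes "arborescence T" "S \<in> root_closed_sets T"
  shows "Digraph_Component.connected (rdigraph T \<restriction> S)"
proof -
  let ?F = "parcs (mk_symmetric (rdigraph T \<restriction> S))"
  have "v \<in> S \<longrightarrow> (root_of T, v) \<in> rtrancl_on S ?F \<and> (v, root_of T) \<in> rtrancl_on S ?F"
    if "(root_of T, v) \<in> (rarcs T)\<^sup>*" for v
    using that
  proof induction
    case (step y z)
    show ?case
    proof
      assume z: "z \<in> S"
      then have y: "y \<in> S" using assms(2) step.hyps by (auto simp: root_closed_sets_def)
      have "(y, z) \<in> ?F" "(z, y) \<in> ?F"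
        using y z step.hyps by (force simp: mk_symmetric_def)+
      then have "(y, z) \<in> rtrancl_on S ?F" "(z, y) \<in> rtrancl_on S ?F"
        using y z by (meson rtrancl_on.intros)+
      then show "(root_of T, z) \<in> rtrancl_on S ?F \<and> (z, root_of T) \<in> rtrancl_on S ?F"
        using step.IH y by (meson rtrancl_on_trans)
    qed
  qed auto
  moreover have "(root_of T, v) \<in> (rarcs T)\<^sup>*" if "v \<in> S" for v
    using that assms(2) arborescence_reachable[OF assms(1)] by (auto simp: root_closed_sets_def)
  ultimately have "(u, v) \<in> rtrancl_on S ?F" if "u \<in> S" "v \<in> S" for u v
    using that rtrancl_on_trans[of u "root_of T" S ?F v] by blast
  moreover have "S \<noteq> {}"
    using assms(2) by (auto simp: root_closed_sets_def)
  ultimately show ?thesis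
    unfolding connected_def strongly_connected_def reachable_def by (simp add: mk_symmetric_def)
qed

lemma root_subtrees_eq:
  assumes "arborescence T"
  shows "root_subtrees T = (\<lambda>S. rdigraph T \<restriction> S) ` root_closed_sets T"
proof (intro equalityI subsetI)
  fix H assume "H \<in> root_subtrees T"
  then have H: "induced_subgraph H (rdigraph T)" "Digraph_Component.connected H" "root_of T \<in> verts H"
    by (auto simp: root_subtrees_def)
  then have "H = rdigraph T \<restriction> verts H"
    by (auto simp: induced_subgraph_def subgraph_def compatible_def induce_subgraph_def
        intro!: pre_digraph.equality)
  moreover have "verts H \<subseteq> rverts T"
    using H by (auto simp: induced_subgraph_def subgraph_def)
  ultimately have "verts H \<in> root_closed_sets T"
    using H root_closed_if_connected[OF assms, of "verts H"] by (auto simp: root_closed_sets_def)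
  with \<open>H = _\<close> show "H \<in> (\<lambda>S. rdigraph T \<restriction> S) ` root_closed_sets T" by blast
next
  fix H assume "H \<in> (\<lambda>S. rdigraph T \<restriction> S) ` root_closed_sets T"
  then obtain S where S: "S \<in> root_closed_sets T" "H = rdigraph T \<restriction> S" by blast
  have "induced_subgraph H (rdigraph T)"
    using fin_digraph_rdigraph[OF assms] S
    by (auto simp: fin_digraph_def root_closed_sets_def induced_subgraph_def subgraph_def
        compatible_def wf_digraph_def)
  then show "H \<in> root_subtrees T"
    using S connected_if_root_closed[OF assms S(1)] by (auto simp: root_subtrees_def root_closed_sets_def)
qed

lemma rank_number_eq:
  assumes "arborescence T"
  shows "rank_number T i = card {S \<in> root_closed_sets T. card S = i}"
proof -
  have "{H \<in> root_subtrees T. card (verts H) = i} =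
      (\<lambda>S. rdigraph T \<restriction> S) ` {S \<in> root_closed_sets T. card S = i}"
    unfolding root_subtrees_eq[OF assms] by auto
  moreover have "inj_on (\<lambda>S. rdigraph T \<restriction> S) A" for A
    by (auto simp: inj_on_def induce_subgraph_def)
  ultimately show ?thesis
    unfolding rank_number_def by (simp add: card_image)
qed

section \<open>Isomorphisms as vertex maps\<close>

definition vertex_iso :: "('a \<Rightarrow> 'b) \<Rightarrow> 'a rooted_digraph \<Rightarrow> 'b rooted_digraph \<Rightarrow> bool" where
  "vertex_iso f T T' \<longleftrightarrow> inj_on f (rverts T) \<and> rverts T' = f ` rverts T \<and>
     rarcs T' = map_prod f f ` rarcs T \<and> root_of T' = f (root_of T)"

text \<open>Tail and head are the projections in both digraphs, so the vertex map determines the arc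
  map.\<close>

lemma rooted_iso_iff_vertex_iso:
  fixes T :: "'a rooted_digraph" and T' :: "'b rooted_digraph"
  assumes wf: "rarcs T \<subseteq> rverts T \<times> rverts T"
  shows "rooted_iso T T' \<longleftrightarrow> (\<exists>f. vertex_iso f T T')"
proof
  assume "rooted_iso T T'"
  then obtain h :: "('a, 'a \<times> 'a, 'b, 'b \<times> 'b) digraph_isomorphism" where h: "pre_digraph.digraph_isomorphism (rdigraph T) h"
    "rdigraph T' = app_iso h (rdigraph T)" "iso_verts h (root_of T) = root_of T'"
    unfolding rooted_iso_def by blast
  have proj: "rverts T' = iso_verts h ` rverts T" "rarcs T' = iso_arcs h ` rarcs T"
    "fst = iso_tail h" "snd = iso_head h"
    using arg_cong[OF h(2), of verts] arg_cong[OF h(2), of arcs] arg_cong[OF h(2), of tail]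
      arg_cong[OF h(2), of head]
    unfolding with_proj_simps app_iso_simps by blast+
  have "iso_arcs h e = map_prod (iso_verts h) (iso_verts h) e" if "e \<in> rarcs T" for e
  proof (rule prod_eqI)
    show "fst (iso_arcs h e) = fst (map_prod (iso_verts h) (iso_verts h) e)"
      "snd (iso_arcs h e) = snd (map_prod (iso_verts h) (iso_verts h) e)"
      using h(1) that unfolding pre_digraph.digraph_isomorphism_def proj(3,4)[symmetric]
      by simp_all
  qed
  then have "rarcs T' = map_prod (iso_verts h) (iso_verts h) ` rarcs T"
    unfolding proj by (rule image_cong[OF refl])
  then have "vertex_iso (iso_verts h) T T'"
    using h proj unfolding vertex_iso_def pre_digraph.digraph_isomorphism_def by simp
  then show "\<exists>f. vertex_iso f T T'" by blast
next
  assume "\<exists>f. vertex_iso f T T'"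
  then obtain f where f: "vertex_iso f T T'" by blast
  define h :: "('a, 'a \<times> 'a, 'b, 'b \<times> 'b) digraph_isomorphism" where
    "h = \<lparr>iso_verts = f, iso_arcs = map_prod f f, iso_head = snd, iso_tail = fst\<rparr>"
  have "inj_on (map_prod f f) (rarcs T)"
    using f inj_on_subset[OF map_prod_inj_on[of f "rverts T" f "rverts T"] wf]
    by (simp add: vertex_iso_def)
  then have "pre_digraph.digraph_isomorphism (rdigraph T) h"
    using f wf unfolding pre_digraph.digraph_isomorphism_def wf_digraph_rdigraph_iff
    by (auto simp: h_def vertex_iso_def)
  moreover have "rdigraph T' = app_iso h (rdigraph T)"
    using f by (intro pre_digraph.equality) (auto simp: h_def vertex_iso_def)
  ultimately show "rooted_iso T T'"
    using f unfolding rooted_iso_def by (intro exI[of _ h]) (auto simp: h_def vertex_iso_def)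
qed

lemma vertex_iso_arcs_subset:
  assumes "vertex_iso f T T'" "rarcs T \<subseteq> rverts T \<times> rverts T"
  shows "rarcs T' \<subseteq> rverts T' \<times> rverts T'"
  using assms by (auto simp: vertex_iso_def)

lemma vertex_iso_comp:
  assumes "vertex_iso f T T'" "vertex_iso g T' T''"
  shows "vertex_iso (g \<circ> f) T T''"
proof -
  have "map_prod (g \<circ> f) (g \<circ> f) ` E = map_prod g g ` map_prod f f ` E" for E
    by (simp add: image_comp map_prod.comp)
  then show ?thesis
    using assms unfolding vertex_iso_def by (metis comp_apply comp_inj_on image_comp)
qed

lemma vertex_iso_inv:
  assumes "vertex_iso f T T'" "rarcs T \<subseteq> rverts T \<times> rverts T" "root_of T \<in> rverts T"
  shows "vertex_iso (the_inv_into (rverts T) f) T' T"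
proof -
  let ?g = "the_inv_into (rverts T) f"
  have inj: "inj_on f (rverts T)" using assms(1) by (simp add: vertex_iso_def)
  have g: "?g (f v) = v" if "v \<in> rverts T" for v
    using inj that by (rule the_inv_into_f_f)
  have "map_prod ?g ?g ` map_prod f f ` rarcs T = id ` rarcs T"
    unfolding image_image using assms(2) g by (intro image_cong) auto
  then show ?thesis
    using assms g inj by (auto simp: vertex_iso_def inj_on_the_inv_into image_image)
qed

lemma root_closed_sets_vertex_iso:
  assumes f: "vertex_iso f T T'" and T: "arborescence T"
  shows "bij_betw (image f) {S \<in> root_closed_sets T. card S = i} {S \<in> root_closed_sets T'. card S = i}"
proof -
  have inj: "inj_on f (rverts T)" using f by (simp add: vertex_iso_def)
  have closed_image_iff: "f ` S \<in> root_closed_sets T' \<longleftrightarrow> S \<in> root_closed_sets T" if S: "S \<subseteq> rverts T" for S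
  proof -
    have mem: "f v \<in> f ` S \<longleftrightarrow> v \<in> S" if "v \<in> rverts T" for v
      using inj_on_image_mem_iff[OF inj that S] .
    have arcs': "(\<forall>u v. (u, v) \<in> rarcs T' \<longrightarrow> v \<in> f ` S \<longrightarrow> u \<in> f ` S) \<longleftrightarrow>
        (\<forall>u v. (u, v) \<in> rarcs T \<longrightarrow> v \<in> S \<longrightarrow> u \<in> S)" (is "?A \<longleftrightarrow> ?B")
    proof -
      have E': "rarcs T' = map_prod f f ` rarcs T"
        using f by (simp add: vertex_iso_def)
      have mem_arc: "f (fst e) \<in> f ` S \<longleftrightarrow> fst e \<in> S" "f (snd e) \<in> f ` S \<longleftrightarrow> snd e \<in> S"
        if "e \<in> rarcs T" for e
        using that mem arborescence_arcs[OF T, of "fst e" "snd e"] by simp_all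
      have "?A \<longleftrightarrow> (\<forall>e\<in>rarcs T'. snd e \<in> f ` S \<longrightarrow> fst e \<in> f ` S)"
        by auto
      also have "\<dots> \<longleftrightarrow> (\<forall>e\<in>rarcs T. f (snd e) \<in> f ` S \<longrightarrow> f (fst e) \<in> f ` S)"
        unfolding E' by simp
      also have "\<dots> \<longleftrightarrow> (\<forall>e\<in>rarcs T. snd e \<in> S \<longrightarrow> fst e \<in> S)"
        by (simp add: mem_arc)
      also have "\<dots> \<longleftrightarrow> ?B"
        by auto
      finally show ?thesis .
    qed
    show ?thesis
      using S f mem[OF arborescence_root[OF T]] image_mono[OF S, of f]
      unfolding root_closed_sets_def mem_Collect_eq arcs' by (simp add: vertex_iso_def)
  qed
  have sub: "S \<subseteq> rverts T" if "S \<in> root_closed_sets T" for S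
    using that by (simp add: root_closed_sets_def)
  have "root_closed_sets T' = image f ` root_closed_sets T"
  proof (intro equalityI subsetI)
    fix S' assume S': "S' \<in> root_closed_sets T'"
    then have "S' \<subseteq> f ` rverts T"
      using f by (simp add: root_closed_sets_def vertex_iso_def)
    then obtain S where "S \<subseteq> rverts T" "S' = f ` S"
      by (rule subset_imageE)
    then show "S' \<in> image f ` root_closed_sets T"
      using closed_image_iff S' by blast
  qed (use closed_image_iff sub in blast)
  moreover have "card (f ` S) = card S" if "S \<in> root_closed_sets T" for S
    using inj_on_subset[OF inj sub[OF that]] by (rule card_image)
  ultimately have "{S \<in> root_closed_sets T'. card S = i} = image f ` {S \<in> root_closed_sets T. card S = i}"
    by (auto simp: image_iff)
  moreover have "inj_on (image f) {S \<in> root_closed_sets T. card S = i}"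
    using inj_on_image_Pow[OF inj] by (rule inj_on_subset) (use sub in auto)
  ultimately show ?thesis
    by (simp add: bij_betw_def)
qed

lemma arborescence_vertex_iso:
  assumes f: "vertex_iso f T T'" and T: "arborescence T"
  shows "arborescence T'"
  unfolding arborescence_def
proof (intro conjI allI impI ballI)
  have inj: "inj_on f (rverts T)" using f by (simp add: vertex_iso_def)
  note arcs = arborescence_arcs[OF T]
  show "finite (rverts T')"
    using f arborescence_finite[OF T] by (simp add: vertex_iso_def)
  show "rarcs T' \<subseteq> rverts T' \<times> rverts T'"
    using vertex_iso_arcs_subset[OF f arborescence_arcs_subset[OF T]] .
  show "root_of T' \<in> rverts T'"
    using f arborescence_root[OF T] by (simp add: vertex_iso_def)
  show "(u, root_of T') \<notin> rarcs T'" for u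
    using f arborescence_no_arc_to_root[OF T] arborescence_root[OF T] arcs inj
    by (auto simp: vertex_iso_def dest: inj_onD)
  show "u = u'" if "(u, v) \<in> rarcs T'" "(u', v) \<in> rarcs T'" for u u' v
    using that f arborescence_parent_unique[OF T] arcs inj
    by (auto simp: vertex_iso_def) (metis inj_on_eq_iff)
  have "(f (root_of T), f v) \<in> (rarcs T')\<^sup>*" if "(root_of T, v) \<in> (rarcs T)\<^sup>*" for v
    using that
  proof induction
    case (step y z)
    then have "(f y, f z) \<in> rarcs T'" using f by (force simp: vertex_iso_def)
    with step.IH show ?case by simp
  qed simp
  then show "(root_of T', v) \<in> (rarcs T')\<^sup>*" if "v \<in> rverts T'" for v
    using that f arborescence_reachable[OF T] by (auto simp: vertex_iso_def)
qed

lemma rank_number_vertex_iso: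
  assumes "vertex_iso f T T'" "arborescence T"
  shows "rank_number T' = rank_number T"
  using bij_betw_same_card[OF root_closed_sets_vertex_iso[OF assms]]
  by (auto simp: rank_number_eq assms(2) arborescence_vertex_iso[OF assms])

section \<open>Brooms and merges\<close>

lemma broom_simps [simp]:
  "rverts (broom m k) = {..k + m}"
  "root_of (broom m k) = 0"
  "(u, v) \<in> rarcs (broom m k) \<longleftrightarrow> u < k \<and> v = Suc u \<or> u = k \<and> k < v \<and> v \<le> k + m"
  by (auto simp: broom_def)

lemma relpow_broom_path: "i \<le> k \<Longrightarrow> (0, i) \<in> rarcs (broom m k) ^^ i"
proof (induction i)
  case (Suc i)
  then have "(0, i) \<in> rarcs (broom m k) ^^ i" "(i, Suc i) \<in> rarcs (broom m k)"
    by simp_all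
  then show ?case by (rule relpow_Suc_I)
qed simp

lemma arborescence_broom: "arborescence (broom m k)"
proof -
  have "(0, v) \<in> (rarcs (broom m k))\<^sup>*" if "v \<le> k + m" for v
  proof (cases "v \<le> k")
    case True
    then show ?thesis by (rule relpow_imp_rtrancl[OF relpow_broom_path])
  next
    case False
    then have "(k, v) \<in> rarcs (broom m k)" using that by simp
    with relpow_imp_rtrancl[OF relpow_broom_path[of k k m]] show ?thesis
      by (simp add: rtrancl.rtrancl_into_rtrancl)
  qed
  moreover have "rarcs (broom m k) \<subseteq> {..k + m} \<times> {..k + m}"
    by (rule subrelI) auto
  ultimately show ?thesis
    unfolding arborescence_def by auto
qed

text \<open>A closed set without \<open>k\<close> has no leaf and is the initial segment up to its
  maximum; a closed set with \<open>k\<close> has the whole path, and its leaves are free.\<close>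

lemma root_closed_sets_broom:
  "root_closed_sets (broom m k) = {S. \<exists>j<k. S = {..j}} \<union> {{..k} \<union> U | U. U \<subseteq> {k<..k + m}}"
  (is "_ = ?A \<union> ?B")
proof (intro equalityI subsetI)
  fix S assume S: "S \<in> root_closed_sets (broom m k)"
  then have S_sub: "S \<subseteq> {..k + m}" and "0 \<in> S"
    and step: "\<And>u. u < k \<Longrightarrow> Suc u \<in> S \<Longrightarrow> u \<in> S"
    and leaf: "\<And>v. k < v \<Longrightarrow> v \<le> k + m \<Longrightarrow> v \<in> S \<Longrightarrow> k \<in> S"
    by (auto simp: root_closed_sets_def)
  have down: "{..x} \<subseteq> S" if "x \<in> S" "x \<le> k" for x
    using that
  proof (induction x)
    case (Suc x)
    then show ?case using step[of x] by (simp add: atMost_Suc)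
  qed simp
  show "S \<in> ?A \<union> ?B"
  proof (cases "k \<in> S")
    case True
    then have "S = {..k} \<union> (S \<inter> {k<..k + m})"
      using down[of k] S_sub by auto
    then show ?thesis by blast
  next
    case False
    have fin: "finite S" using S_sub finite_subset by blast
    have max: "Max S \<in> S" using fin \<open>0 \<in> S\<close> by (intro Max_in) auto
    have "Max S \<le> k + m" using max S_sub by auto
    then have "Max S < k"
      using False leaf[of "Max S"] max by (metis linorder_neqE_nat)
    moreover have "S = {..Max S}"
      using down[of "Max S"] max calculation fin by auto
    ultimately show ?thesis by blast
  qed
next
  fix S assume "S \<in> ?A \<union> ?B"
  then show "S \<in> root_closed_sets (broom m k)"
    by (auto simp: root_closed_sets_def subset_iff)
qed

lemma finite_root_closed_sets:
  assumes "arborescence T"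
  shows "finite (root_closed_sets T)"
  by (rule finite_subset[of _ "Pow (rverts T)"])
    (auto simp: root_closed_sets_def arborescence_finite[OF assms])

lemma rank_number_broom:
  "rank_number (broom m k) (Suc i) = (if i < k then 1 else m choose (i - k))"
proof -
  have card: "card ({..k} \<union> U) = Suc (k + card U)" if "U \<subseteq> {k<..k + m}" for U
  proof -
    have "finite U" using that finite_subset by blast
    moreover have "{..k} \<inter> U = {}" using that by auto
    ultimately show ?thesis by (simp add: card_Un_disjoint)
  qed
  show ?thesis
  proof (cases "i < k")
    case True
    then have "{S \<in> root_closed_sets (broom m k). card S = Suc i} = {{..i}}"
      by (auto simp: root_closed_sets_broom card)
    then show ?thesis
      using True by (simp add: rank_number_eq[OF arborescence_broom])
  next
    case False
    then have "{S \<in> root_closed_sets (broom m k). card S = Suc i} =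
        (\<lambda>U. {..k} \<union> U) ` {U. U \<subseteq> {k<..k + m} \<and> card U = i - k}"
      by (auto simp: root_closed_sets_broom card)
    moreover have "inj_on (\<lambda>U. {..k} \<union> U) {U. U \<subseteq> {k<..k + m} \<and> card U = i - k}"
      by (rule inj_on_inverseI[where g = "\<lambda>S. S - {..k}"]) auto
    ultimately show ?thesis
      using False n_subsets[of "{k<..k + m}" "i - k"]
      by (simp add: rank_number_eq[OF arborescence_broom] card_image)
  qed
qed

lemma merge_simps [simp]:
  "rverts (rooted_merge T1 T2) = Inl ` rverts T1 \<union> merge_inr T1 T2 ` rverts T2"
  "root_of (rooted_merge T1 T2) = Inl (root_of T1)"
  by (simp_all add: rooted_merge_def)

lemma rarcs_merge_iff:
  "(x, y) \<in> rarcs (rooted_merge T1 T2) \<longleftrightarrow>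
     (\<exists>a b. (a, b) \<in> rarcs T1 \<and> x = Inl a \<and> y = Inl b) \<or>
     (\<exists>a b. (a, b) \<in> rarcs T2 \<and> x = merge_inr T1 T2 a \<and> y = merge_inr T1 T2 b)"
  by (auto simp: rooted_merge_def)

lemma merge_inr_root [simp]: "merge_inr T1 T2 (root_of T2) = Inl (root_of T1)"
  by (simp add: merge_inr_def)

lemma merge_inr_eq_iff [simp]:
  "merge_inr T1 T2 b = merge_inr T1 T2 b' \<longleftrightarrow> b = b'"
  "merge_inr T1 T2 b = Inl a \<longleftrightarrow> b = root_of T2 \<and> a = root_of T1"
  "Inl a = merge_inr T1 T2 b \<longleftrightarrow> b = root_of T2 \<and> a = root_of T1"
  by (auto simp: merge_inr_def)

lemma inj_merge_inr: "inj (merge_inr T1 T2)"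
  by (rule injI) simp

lemma arborescence_merge:
  assumes T1: "arborescence T1" and T2: "arborescence T2"
  shows "arborescence (rooted_merge T1 T2)"
proof -
  let ?E = "rarcs (rooted_merge T1 T2)"
  have 1: "(Inl (root_of T1), Inl a) \<in> ?E\<^sup>*" if "(root_of T1, a) \<in> (rarcs T1)\<^sup>*" for a
    using that
    by induction (auto simp: rarcs_merge_iff intro: rtrancl.rtrancl_into_rtrancl)
  have 2: "(Inl (root_of T1), merge_inr T1 T2 b) \<in> ?E\<^sup>*" if "(root_of T2, b) \<in> (rarcs T2)\<^sup>*" for b
    using that
  proof induction
    case (step y z)
    then have "(merge_inr T1 T2 y, merge_inr T1 T2 z) \<in> ?E" by (auto simp: rarcs_merge_iff)
    with step.IH show ?case by (rule rtrancl.rtrancl_into_rtrancl)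
  qed simp
  show ?thesis
    unfolding arborescence_def
  proof (intro conjI allI impI ballI)
    show "?E \<subseteq> rverts (rooted_merge T1 T2) \<times> rverts (rooted_merge T1 T2)"
      using arborescence_arcs[OF T1] arborescence_arcs[OF T2]
      by (intro subrelI) (auto simp: rarcs_merge_iff)
    show "u = u'" if "(u, v) \<in> ?E" "(u', v) \<in> ?E" for u u' v
      using that arborescence_parent_unique[OF T1] arborescence_parent_unique[OF T2]
        arborescence_no_arc_to_root[OF T1] arborescence_no_arc_to_root[OF T2]
      by (auto simp: rarcs_merge_iff)
    show "(u, root_of (rooted_merge T1 T2)) \<notin> ?E" for u
      using arborescence_no_arc_to_root[OF T1] arborescence_no_arc_to_root[OF T2]
      by (auto simp: rarcs_merge_iff)
    show "(root_of (rooted_merge T1 T2), v) \<in> ?E\<^sup>*" if "v \<in> rverts (rooted_merge T1 T2)" for v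
      using that 1 2 arborescence_reachable[OF T1] arborescence_reachable[OF T2] by auto
  qed (use arborescence_finite[OF T1] arborescence_finite[OF T2] arborescence_root[OF T1] in auto)
qed

text \<open>Taking preimages under the two embeddings inverts the union; the overlap does no harm
  because every closed set contains the root.\<close>

lemma root_closed_sets_merge:
  assumes T1: "arborescence T1" and T2: "arborescence T2"
  shows "bij_betw (\<lambda>(S1, S2). Inl ` S1 \<union> merge_inr T1 T2 ` S2)
    (root_closed_sets T1 \<times> root_closed_sets T2) (root_closed_sets (rooted_merge T1 T2))"
proof (rule bij_betw_byWitness[where f' = "\<lambda>S. (Inl -` S, merge_inr T1 T2 -` S)"])
  show "\<forall>P\<in>root_closed_sets T1 \<times> root_closed_sets T2.
      (\<lambda>S. (Inl -` S, merge_inr T1 T2 -` S)) ((\<lambda>(S1, S2). Inl ` S1 \<union> merge_inr T1 T2 ` S2) P) = P"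
    by (auto simp: root_closed_sets_def)
  show "\<forall>S\<in>root_closed_sets (rooted_merge T1 T2).
      (\<lambda>(S1, S2). Inl ` S1 \<union> merge_inr T1 T2 ` S2) (Inl -` S, merge_inr T1 T2 -` S) = S"
    by (auto simp: root_closed_sets_def)
  show "(\<lambda>(S1, S2). Inl ` S1 \<union> merge_inr T1 T2 ` S2) ` (root_closed_sets T1 \<times> root_closed_sets T2)
      \<subseteq> root_closed_sets (rooted_merge T1 T2)"
  proof (intro subsetI, elim imageE SigmaE, simp only: prod.case)
    fix S1 S2 assume S1: "S1 \<in> root_closed_sets T1" and S2: "S2 \<in> root_closed_sets T2"
    have "u \<in> Inl ` S1 \<union> merge_inr T1 T2 ` S2"
      if "(u, v) \<in> rarcs (rooted_merge T1 T2)" "v \<in> Inl ` S1 \<union> merge_inr T1 T2 ` S2" for u v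
      using that S1 S2 arborescence_no_arc_to_root[OF T1] arborescence_no_arc_to_root[OF T2]
      by (auto simp: rarcs_merge_iff root_closed_sets_def)
    then show "Inl ` S1 \<union> merge_inr T1 T2 ` S2 \<in> root_closed_sets (rooted_merge T1 T2)"
      using S1 S2 unfolding root_closed_sets_def by auto
  qed
  show "(\<lambda>S. (Inl -` S, merge_inr T1 T2 -` S)) ` root_closed_sets (rooted_merge T1 T2)
      \<subseteq> root_closed_sets T1 \<times> root_closed_sets T2"
  proof (intro subsetI, elim imageE, simp only:, intro SigmaI)
    fix S assume "S \<in> root_closed_sets (rooted_merge T1 T2)"
    then have sub: "S \<subseteq> Inl ` rverts T1 \<union> merge_inr T1 T2 ` rverts T2" and root: "Inl (root_of T1) \<in> S"
      and closed: "\<And>u v. (u, v) \<in> rarcs (rooted_merge T1 T2) \<Longrightarrow> v \<in> S \<Longrightarrow> u \<in> S"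
      by (auto simp: root_closed_sets_def)
    have "Inl -` S \<subseteq> rverts T1" "merge_inr T1 T2 -` S \<subseteq> rverts T2"
      using sub arborescence_root[OF T1] arborescence_root[OF T2] by (auto dest!: subsetD)
    moreover have "Inl u \<in> S" if "(u, v) \<in> rarcs T1" "Inl v \<in> S" for u v
      using closed[of "Inl u" "Inl v"] that by (auto simp: rarcs_merge_iff)
    moreover have "merge_inr T1 T2 u \<in> S" if "(u, v) \<in> rarcs T2" "merge_inr T1 T2 v \<in> S" for u v
      using closed[of "merge_inr T1 T2 u" "merge_inr T1 T2 v"] that by (auto simp: rarcs_merge_iff)
    ultimately show "Inl -` S \<in> root_closed_sets T1" "merge_inr T1 T2 -` S \<in> root_closed_sets T2"
      using root by (auto simp: root_closed_sets_def)
  qed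
qed

lemma card_merge_sets:
  assumes "finite S1" "finite S2" "root_of T1 \<in> S1" "root_of T2 \<in> S2"
  shows "card (Inl ` S1 \<union> merge_inr T1 T2 ` S2) + 1 = card S1 + card S2"
proof -
  have "card (Inl ` S1 :: ('a + 'b) set) + card (merge_inr T1 T2 ` S2) =
      card (Inl ` S1 \<union> merge_inr T1 T2 ` S2) + card (Inl ` S1 \<inter> merge_inr T1 T2 ` S2)"
    using assms by (intro card_Un_Int) auto
  moreover have "Inl ` S1 \<inter> merge_inr T1 T2 ` S2 = {Inl (root_of T1)}"
    using assms by (auto simp: image_iff intro: bexI[of _ "root_of T2"])
  moreover have "card (Inl ` S1 :: ('a + 'b) set) = card S1"
    by (rule card_image) simp
  moreover have "card (merge_inr T1 T2 ` S2) = card S2"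
    by (rule card_image) (rule inj_on_subset[OF inj_merge_inr subset_UNIV])
  ultimately show ?thesis by simp
qed

text \<open>The shared root is counted once: sizes \<open>k + 1\<close> and \<open>i - k + 1\<close>
  merge to \<open>i + 1\<close>, so the rank numbers convolve after a shift by one.\<close>

lemma rank_number_merge:
  assumes T1: "arborescence T1" and T2: "arborescence T2"
  shows "rank_number (rooted_merge T1 T2) (Suc i) =
    (\<Sum>k\<le>i. rank_number T1 (Suc k) * rank_number T2 (Suc (i - k)))"
proof -
  let ?F = "\<lambda>(S1, S2). Inl ` S1 \<union> merge_inr T1 T2 ` S2"
  define C1 where "C1 k = {S \<in> root_closed_sets T1. card S = k}" for k
  define C2 where "C2 k = {S \<in> root_closed_sets T2. card S = k}" for k
  note bij = root_closed_sets_merge[OF T1 T2]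
  have fin: "finite (C1 k)" "finite (C2 k)" for k
    using finite_root_closed_sets[OF T1] finite_root_closed_sets[OF T2] by (simp_all add: C1_def C2_def)
  have closed_finite: "finite S1" "finite S2" "root_of T1 \<in> S1" "root_of T2 \<in> S2"
    if "S1 \<in> root_closed_sets T1" "S2 \<in> root_closed_sets T2" for S1 S2
    using that arborescence_finite[OF T1] arborescence_finite[OF T2]
    by (auto simp: root_closed_sets_def intro: finite_subset)
  have card: "card (?F P) = Suc i \<longleftrightarrow> P \<in> (\<Union>k\<le>i. C1 (Suc k) \<times> C2 (Suc (i - k)))"
    if P: "P \<in> root_closed_sets T1 \<times> root_closed_sets T2" for P
  proof -
    obtain S1 S2 where S: "P = (S1, S2)" "S1 \<in> root_closed_sets T1" "S2 \<in> root_closed_sets T2"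
      using P by blast
    note fin = closed_finite[OF S(2,3)]
    have pos: "card S1 > 0" "card S2 > 0"
      using fin by (auto simp: card_gt_0_iff)
    have "card (?F P) = Suc i \<longleftrightarrow> card S1 + card S2 = Suc (Suc i)"
      using card_merge_sets[OF fin] by (auto simp: S)
    also have "\<dots> \<longleftrightarrow> (\<exists>k\<le>i. card S1 = Suc k \<and> card S2 = Suc (i - k))"
      using pos by (auto intro!: exI[of _ "card S1 - 1"])
    finally show ?thesis using S by (auto simp: C1_def C2_def)
  qed
  have "{S \<in> root_closed_sets (rooted_merge T1 T2). card S = Suc i} =
      ?F ` {P \<in> root_closed_sets T1 \<times> root_closed_sets T2. card (?F P) = Suc i}"
    unfolding bij_betw_imp_surj_on[OF bij, symmetric] by blast
  also have "{P \<in> root_closed_sets T1 \<times> root_closed_sets T2. card (?F P) = Suc i} =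
      (\<Union>k\<le>i. C1 (Suc k) \<times> C2 (Suc (i - k)))" (is "_ = ?U")
    using card by (auto simp: C1_def C2_def)
  finally have "card {S \<in> root_closed_sets (rooted_merge T1 T2). card S = Suc i} = card (?F ` ?U)"
    by simp
  also have "\<dots> = card ?U"
    by (rule card_image, rule inj_on_subset[OF bij_betw_imp_inj_on[OF bij]])
      (auto simp: C1_def C2_def)
  also have "\<dots> = (\<Sum>k\<le>i. card (C1 (Suc k) \<times> C2 (Suc (i - k))))"
    using fin by (intro card_UN_disjoint) (auto simp: C1_def)
  finally show ?thesis
    by (simp add: rank_number_eq arborescence_merge T1 T2 C1_def C2_def card_cartesian_product)
qed

section \<open>An invariant that recovers the brooms\<close>

text \<open>The root is left out because its children come from both trees of a merge;
  \<open>2 \<le> c\<close> discards leaves and inner path vertices.\<close>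

definition branching :: "'a rooted_digraph \<Rightarrow> (nat \<times> nat) set" where
  "branching T = {(d, c). 2 \<le> c \<and>
     (\<exists>v. v \<noteq> root_of T \<and> (root_of T, v) \<in> rarcs T ^^ d \<and> card (rarcs T `` {v}) = c)}"

lemma relpow_map:
  assumes "(a, b) \<in> E ^^ d" "\<And>u v. (u, v) \<in> E \<Longrightarrow> (f u, f v) \<in> E'"
  shows "(f a, f b) \<in> E' ^^ d"
  using assms(1) by (induction d arbitrary: b) (auto intro: assms(2) relpow_Suc_I)

lemma branching_vertex_iso_subset:
  assumes f: "vertex_iso f T T'" and T: "arborescence T"
  shows "branching T \<subseteq> branching T'"
proof
  fix x assume "x \<in> branching T"
  then obtain d v where x: "x = (d, card (rarcs T `` {v}))" "2 \<le> card (rarcs T `` {v})"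
    and v: "v \<noteq> root_of T" "(root_of T, v) \<in> rarcs T ^^ d"
    by (auto simp: branching_def)
  have inj: "inj_on f (rverts T)" using f by (simp add: vertex_iso_def)
  have "rarcs T `` {v} \<noteq> {}" using x(2) by auto
  then have vT: "v \<in> rverts T" using arborescence_arcs[OF T] by blast
  have "rarcs T' `` {f v} = f ` (rarcs T `` {v})"
    using f arborescence_arcs[OF T] vT inj_onD[OF inj] by (auto simp: vertex_iso_def) blast
  moreover have "card (f ` (rarcs T `` {v})) = card (rarcs T `` {v})"
    using arborescence_arcs[OF T] by (intro card_image inj_on_subset[OF inj]) auto
  moreover have "(root_of T', f v) \<in> rarcs T' ^^ d"
    using relpow_map[OF v(2), of f "rarcs T'"] f by (force simp: vertex_iso_def)
  moreover have "f v \<noteq> root_of T'"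
    using v(1) vT arborescence_root[OF T] f inj_onD[OF inj] by (auto simp: vertex_iso_def)
  ultimately show "x \<in> branching T'"
    using x unfolding branching_def by force
qed

lemma branching_vertex_iso:
  assumes f: "vertex_iso f T T'" and T: "arborescence T"
  shows "branching T' = branching T"
  using branching_vertex_iso_subset[OF assms]
    branching_vertex_iso_subset[OF vertex_iso_inv[OF f] arborescence_vertex_iso[OF assms]]
    arborescence_arcs_subset[OF T] arborescence_root[OF T] by blast

text \<open>The path end is the only vertex with several children, and \<open>k \<ge> 1\<close>
  keeps it apart from the root, which \<open>branching\<close> skips.\<close>

lemma branching_broom:
  assumes "k \<ge> 1" "m \<ge> 2"
  shows "branching (broom m k) = {(k, m)}"
proof -
  have depth: "d = min v (Suc k)" if "(0, v) \<in> rarcs (broom m k) ^^ d" for v d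
    using that
  proof (induction d arbitrary: v)
    case (Suc d)
    then obtain u where "(0, u) \<in> rarcs (broom m k) ^^ d" "(u, v) \<in> rarcs (broom m k)"
      by (auto elim: relpow_Suc_E)
    with Suc.IH[of u] show ?case by auto
  qed simp
  have out: "rarcs (broom m k) `` {v} = (if v < k then {Suc v} else if v = k then {k<..k + m} else {})" for v
    by auto
  show ?thesis
  proof (intro equalityI subsetI)
    fix x assume "x \<in> branching (broom m k)"
    then show "x \<in> {(k, m)}"
      using assms by (auto simp: branching_def out split: if_splits dest: depth)
  next
    fix x assume "x \<in> {(k, m)}"
    then show "x \<in> branching (broom m k)"
      using assms relpow_broom_path[of k k m] by (auto simp: branching_def out)
  qed
qed

lemma relpow_root_eq_0:
  assumes "arborescence T" "(root_of T, root_of T) \<in> rarcs T ^^ d"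
  shows "d = 0"
  using assms arborescence_no_arc_to_root[OF assms(1)] by (cases d) (auto elim: relpow_Suc_E)

text \<open>A walk could change sides only at the root, and no nonempty walk returns there.\<close>

lemma relpow_merge_iff:
  assumes T1: "arborescence T1" and T2: "arborescence T2"
  shows "(Inl (root_of T1), x) \<in> rarcs (rooted_merge T1 T2) ^^ d \<longleftrightarrow>
    (\<exists>a. x = Inl a \<and> (root_of T1, a) \<in> rarcs T1 ^^ d) \<or>
    (\<exists>b. x = merge_inr T1 T2 b \<and> (root_of T2, b) \<in> rarcs T2 ^^ d)" (is "?L x d \<longleftrightarrow> ?R x d")
proof
  show "?L x d \<Longrightarrow> ?R x d"
  proof (induction d arbitrary: x)
    case (Suc d)
    then obtain y where y: "?L y d" "(y, x) \<in> rarcs (rooted_merge T1 T2)" by (auto elim: relpow_Suc_E)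
    from y(2) consider
      (left) a b where "(a, b) \<in> rarcs T1" "y = Inl a" "x = Inl b" |
      (right) a b where "(a, b) \<in> rarcs T2" "y = merge_inr T1 T2 a" "x = merge_inr T1 T2 b"
      by (auto simp: rarcs_merge_iff)
    then show ?case
    proof cases
      case left
      have "(root_of T1, a) \<in> rarcs T1 ^^ d"
        using Suc.IH[OF y(1)] by (auto simp: left dest: relpow_root_eq_0[OF T2])
      then show ?thesis using left by (auto intro: relpow_Suc_I)
    next
      case right
      have "(root_of T2, a) \<in> rarcs T2 ^^ d"
        using Suc.IH[OF y(1)] by (auto simp: right dest: relpow_root_eq_0[OF T1])
      then show ?thesis using right by (auto intro: relpow_Suc_I)
    qed
  qed auto
  show "?R x d \<Longrightarrow> ?L x d"
    using relpow_map[of "root_of T1" _ d "rarcs T1" Inl "rarcs (rooted_merge T1 T2)"]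
      relpow_map[of "root_of T2" _ d "rarcs T2" "merge_inr T1 T2" "rarcs (rooted_merge T1 T2)"]
    by (auto simp: rarcs_merge_iff)
qed

lemma branching_merge:
  assumes T1: "arborescence T1" and T2: "arborescence T2"
  shows "branching (rooted_merge T1 T2) = branching T1 \<union> branching T2"
proof -
  have left: "card (rarcs (rooted_merge T1 T2) `` {Inl a}) = card (rarcs T1 `` {a})"
    if "a \<noteq> root_of T1" for a
  proof -
    have "rarcs (rooted_merge T1 T2) `` {Inl a} = Inl ` (rarcs T1 `` {a})"
      using that by (auto simp: rarcs_merge_iff)
    then show ?thesis by (simp add: card_image)
  qed
  have right: "card (rarcs (rooted_merge T1 T2) `` {merge_inr T1 T2 b}) = card (rarcs T2 `` {b})"
    if "b \<noteq> root_of T2" for b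
  proof -
    have "rarcs (rooted_merge T1 T2) `` {merge_inr T1 T2 b} = merge_inr T1 T2 ` (rarcs T2 `` {b})"
      using that by (auto simp: rarcs_merge_iff)
    then show ?thesis
      by (simp add: card_image inj_on_subset[OF inj_merge_inr subset_UNIV])
  qed
  have "(d, c) \<in> branching (rooted_merge T1 T2) \<longleftrightarrow> (d, c) \<in> branching T1 \<union> branching T2" for d c
  proof -
    have "(d, c) \<in> branching (rooted_merge T1 T2) \<longleftrightarrow> 2 \<le> c \<and>
      ((\<exists>a. a \<noteq> root_of T1 \<and> (root_of T1, a) \<in> rarcs T1 ^^ d \<and>
          card (rarcs (rooted_merge T1 T2) `` {Inl a}) = c) \<or>
       (\<exists>b. b \<noteq> root_of T2 \<and> (root_of T2, b) \<in> rarcs T2 ^^ d \<and>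
          card (rarcs (rooted_merge T1 T2) `` {merge_inr T1 T2 b}) = c))"
      unfolding branching_def merge_simps relpow_merge_iff[OF T1 T2] mem_Collect_eq prod.case
      by (auto, metis merge_inr_eq_iff(2))
    then show ?thesis
      using left right by (auto simp: branching_def)
  qed
  then show ?thesis by auto
qed

text \<open>The left summand goes through \<open>merge_inr T2 T1\<close>, so that the common root is
  sent to its representative \<open>Inl (root_of T2)\<close>.\<close>

lemma vertex_iso_merge_commute:
  "vertex_iso (case_sum (merge_inr T2 T1) Inl) (rooted_merge T1 T2) (rooted_merge T2 T1)"
proof -
  let ?f = "case_sum (merge_inr T2 T1) Inl"
  have f: "?f (Inl a) = merge_inr T2 T1 a" "?f (merge_inr T1 T2 b) = Inl b" for a b
    by (auto simp: merge_inr_def)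
  have "inj_on ?f (rverts (rooted_merge T1 T2))"
    by (auto simp: inj_on_def f simp del: sum.case)
  then show ?thesis
    unfolding vertex_iso_def
    by (auto simp: f rooted_merge_def image_Un image_image map_prod_def split_def simp del: sum.case)
qed

section \<open>The classification\<close>

text \<open>As \<open>d i\<close> compares the positions \<open>i\<close> and \<open>i + 1\<close>,
  a peak at \<open>k\<close> is a sign change at \<open>k - 1\<close>.\<close>

lemma unimodal_iff_sign_change:
  assumes r: "\<And>i. r (Suc i) = c i" and d: "\<And>i. d (Suc i) = int (c (Suc i)) - int (c i)"
  shows "unimodal r \<longleftrightarrow> (\<exists>t. sign_change_at d t)"
proof -
  have step: "r i \<le> r (i + 1) \<longleftrightarrow> 0 \<le> d i" "r (i + 1) \<le> r i \<longleftrightarrow> d i \<le> 0" if "1 \<le> i" for i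
    using that by (cases i; simp add: r d)+
  show ?thesis
  proof
    assume "unimodal r"
    then obtain k where k: "1 \<le> k" "\<forall>i. 1 \<le> i \<and> i < k \<longrightarrow> r i \<le> r (i + 1)" "\<forall>i\<ge>k. r (i + 1) \<le> r i"
      unfolding unimodal_def by blast
    have "sign_change_at d (k - 1)"
      unfolding sign_change_at_def
    proof (intro conjI allI impI)
      fix i assume "1 \<le> i \<and> i \<le> k - 1"
      then have "1 \<le> i" "i < k" using k(1) by linarith+
      then show "0 \<le> d i" using k(2) step(1)[of i] by blast
    next
      fix i assume "k - 1 < i"
      then have "1 \<le> i" "k \<le> i" by linarith+
      then show "d i \<le> 0" using k(3) step(2)[of i] by blast
    qed
    then show "\<exists>t. sign_change_at d t" ..
  next
    assume "\<exists>t. sign_change_at d t"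
    then obtain t where t: "sign_change_at d t" ..
    show "unimodal r"
      unfolding unimodal_def
    proof (intro exI[of _ "t + 1"] conjI allI impI)
      fix i assume "1 \<le> i \<and> i < t + 1"
      then show "r i \<le> r (i + 1)" using t step(1)[of i] by (simp add: sign_change_at_def)
    next
      fix i assume "t + 1 \<le> i"
      then show "r (i + 1) \<le> r i" using t step(2)[of i] by (simp add: sign_change_at_def)
    qed simp
  qed
qed

lemma arborescence_merge_broom: "arborescence (rooted_merge (broom m p) (broom n q))"
  by (intro arborescence_merge arborescence_broom)

lemma rank_number_merge_broom:
  "rank_number (rooted_merge (broom m p) (broom n q)) (Suc i) = merge_coeff m p n q i"
  by (simp only: rank_number_merge arborescence_broom rank_number_broom merge_coeff_def broom_coeff_def)

lemma rank_unimodal_merge_broom_iff: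
  assumes "1 \<le> m" "1 \<le> n"
  shows "rank_unimodal (rooted_merge (broom m p) (broom n q)) \<longleftrightarrow>
    \<not> (2 \<le> m \<and> 2 \<le> n \<and> n \<le> p \<and> m \<le> q \<and> 5 \<le> m + n)"
proof -
  have "unimodal (rank_number (rooted_merge (broom m p) (broom n q))) \<longleftrightarrow>
      (\<exists>t. sign_change_at (merge_diff m p n q) t)"
    by (rule unimodal_iff_sign_change[where c = "merge_coeff m p n q"])
      (rule rank_number_merge_broom merge_diff_Suc)+
  then show ?thesis
    unfolding rank_unimodal_def using merge_diff_sign_change_iff[OF assms] by simp
qed

lemma card_rverts_merge_broom:
  "card (rverts (rooted_merge (broom m p) (broom n q))) = Suc (p + m + (q + n))"
  using card_merge_sets[of "rverts (broom m p)" "rverts (broom n q)" "broom m p" "broom n q"] by simp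

lemma branching_merge_broom:
  assumes "((p, m), (q, n)) \<in> non_unimodal_pairs i"
  shows "branching (rooted_merge (broom m p) (broom n q)) = {(p, m), (q, n)}"
proof -
  have "1 \<le> p" "2 \<le> m" "1 \<le> q" "2 \<le> n" using assms by (auto simp: non_unimodal_pairs_def)
  then show ?thesis
    by (simp add: branching_merge arborescence_broom branching_broom insert_commute)
qed

lemma card_rverts_vertex_iso: "vertex_iso f T T' \<Longrightarrow> card (rverts T') = card (rverts T)"
  by (simp add: vertex_iso_def card_image)

text \<open>Vertex count, tree property and rank numbers all transfer along the isomorphism, which
  reduces membership to a numerical condition on the merge.\<close>

lemma non_unimodal_broom_merges_iff:
  "T \<in> non_unimodal_broom_merges i \<longleftrightarrow>
    (\<exists>p m q n f. ((p, m), (q, n)) \<in> non_unimodal_pairs i \<and> vertex_iso f (rooted_merge (broom m p) (broom n q)) T)"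
proof
  assume T: "T \<in> non_unimodal_broom_merges i"
  then obtain m n p q where mn: "m > 0" "n > 0"
    and iso: "rooted_iso T (rooted_merge (broom m p) (broom n q))"
    and nu: "\<not> rank_unimodal T" and card: "card (rverts T) = i" and tree: "rooted_tree T"
    unfolding non_unimodal_broom_merges_def by blast
  let ?M = "rooted_merge (broom m p) (broom n q)"
  have arcs: "rarcs T \<subseteq> rverts T \<times> rverts T" and root: "root_of T \<in> rverts T"
    using tree unfolding rooted_tree_def fin_digraph_def wf_digraph_rdigraph_iff by blast+
  obtain g where g: "vertex_iso g T ?M"
    using iso rooted_iso_iff_vertex_iso[OF arcs] by blast
  define f where "f = the_inv_into (rverts T) g"
  have f: "vertex_iso f ?M T"
    unfolding f_def by (rule vertex_iso_inv[OF g arcs root])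
  have "\<not> rank_unimodal ?M"
    using nu rank_number_vertex_iso[OF f arborescence_merge_broom]
    unfolding rank_unimodal_def by metis
  moreover have "Suc (p + m + (q + n)) = i"
    using card_rverts_merge_broom[of m p n q] card_rverts_vertex_iso[OF f] card by linarith
  ultimately have "((p, m), (q, n)) \<in> non_unimodal_pairs i"
    using rank_unimodal_merge_broom_iff[of m n p q] mn by (auto simp: non_unimodal_pairs_def)
  with f show "\<exists>p m q n f. ((p, m), (q, n)) \<in> non_unimodal_pairs i \<and> vertex_iso f (rooted_merge (broom m p) (broom n q)) T"
    by blast
next
  assume "\<exists>p m q n f. ((p, m), (q, n)) \<in> non_unimodal_pairs i \<and> vertex_iso f (rooted_merge (broom m p) (broom n q)) T"
  then obtain p m q n f where bad: "((p, m), (q, n)) \<in> non_unimodal_pairs i"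
    and f: "vertex_iso f (rooted_merge (broom m p) (broom n q)) T"
    by blast
  let ?M = "rooted_merge (broom m p) (broom n q)"
  have M: "arborescence ?M" by (rule arborescence_merge_broom)
  have T: "arborescence T" by (rule arborescence_vertex_iso[OF f M])
  have "vertex_iso (the_inv_into (rverts ?M) f) T ?M"
    by (rule vertex_iso_inv[OF f arborescence_arcs_subset[OF M] arborescence_root[OF M]])
  then have "rooted_iso T ?M"
    using rooted_iso_iff_vertex_iso[OF arborescence_arcs_subset[OF T]] by blast
  moreover have "card (rverts T) = i"
    using bad card_rverts_merge_broom[of m p n q] card_rverts_vertex_iso[OF f] by (simp add: non_unimodal_pairs_def)
  moreover have "\<not> rank_unimodal ?M"
    using bad rank_unimodal_merge_broom_iff[of m n p q] by (simp add: non_unimodal_pairs_def)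
  then have "\<not> rank_unimodal T"
    using rank_number_vertex_iso[OF f M] unfolding rank_unimodal_def by metis
  moreover have "m > 0" "n > 0" using bad by (auto simp: non_unimodal_pairs_def)
  ultimately show "T \<in> non_unimodal_broom_merges i"
    unfolding non_unimodal_broom_merges_def using rooted_tree_if_arborescence[OF T] by blast
qed

lemma non_unimodal_arborescence: "T \<in> non_unimodal_broom_merges i \<Longrightarrow> arborescence T"
proof -
  assume "T \<in> non_unimodal_broom_merges i"
  then obtain p m q n f where "vertex_iso f (rooted_merge (broom m p) (broom n q)) T"
    unfolding non_unimodal_broom_merges_iff by blast
  then show ?thesis by (rule arborescence_vertex_iso[OF _ arborescence_merge_broom])
qed

lemma branching_image_non_unimodal_broom_merges:
  "branching ` non_unimodal_broom_merges i = (\<lambda>(a, b). {a, b}) ` non_unimodal_pairs i"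
proof (intro equalityI subsetI)
  fix B assume "B \<in> branching ` non_unimodal_broom_merges i"
  then obtain T where "B = branching T" "T \<in> non_unimodal_broom_merges i" by blast
  then obtain p m q n f where bad: "((p, m), (q, n)) \<in> non_unimodal_pairs i"
    and f: "vertex_iso f (rooted_merge (broom m p) (broom n q)) T"
    unfolding non_unimodal_broom_merges_iff by blast
  have "B = {(p, m), (q, n)}"
    using \<open>B = branching T\<close> branching_vertex_iso[OF f arborescence_merge_broom]
      branching_merge_broom[OF bad] by simp
  with bad show "B \<in> (\<lambda>(a, b). {a, b}) ` non_unimodal_pairs i" by (intro image_eqI) auto
next
  fix B assume "B \<in> (\<lambda>(a, b). {a, b}) ` non_unimodal_pairs i"
  then obtain p m q n where bad: "((p, m), (q, n)) \<in> non_unimodal_pairs i" and B: "B = {(p, m), (q, n)}"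
    by auto
  let ?M = "rooted_merge (broom m p) (broom n q)"
  \<comment> \<open>\<open>sum_encode\<close> moves the merge onto the natural numbers, so every
    pair is realised by a counted tree.\<close>
  define T where "T = \<lparr>graph_of = \<lparr>pverts = sum_encode ` rverts ?M,
      parcs = map_prod sum_encode sum_encode ` rarcs ?M\<rparr>, root_of = sum_encode (root_of ?M)\<rparr>"
  have f: "vertex_iso sum_encode ?M T"
    using inj_sum_encode by (simp add: vertex_iso_def T_def)
  then have "T \<in> non_unimodal_broom_merges i"
    using bad non_unimodal_broom_merges_iff by blast
  moreover have "branching T = B"
    using branching_vertex_iso[OF f arborescence_merge_broom] branching_merge_broom[OF bad] B by simp
  ultimately show "B \<in> branching ` non_unimodal_broom_merges i" by blast
qed

text \<open>Equal invariants mean the same two brooms up to order, and swapping them is an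
  isomorphism.\<close>

lemma rooted_iso_if_branching_eq:
  assumes "T \<in> non_unimodal_broom_merges i" "T' \<in> non_unimodal_broom_merges i"
    and eq: "branching T = branching T'"
  shows "rooted_iso T T'"
proof -
  obtain p m q n f where bad: "((p, m), (q, n)) \<in> non_unimodal_pairs i"
    and f: "vertex_iso f (rooted_merge (broom m p) (broom n q)) T"
    using assms(1) unfolding non_unimodal_broom_merges_iff by blast
  obtain p' m' q' n' f' where bad': "((p', m'), (q', n')) \<in> non_unimodal_pairs i"
    and f': "vertex_iso f' (rooted_merge (broom m' p') (broom n' q')) T'"
    using assms(2) unfolding non_unimodal_broom_merges_iff by blast
  let ?M = "rooted_merge (broom m p) (broom n q)" and ?M' = "rooted_merge (broom m' p') (broom n' q')"
  have M: "arborescence ?M" by (rule arborescence_merge_broom)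
  have "{(p, m), (q, n)} = {(p', m'), (q', n')}"
    using eq branching_vertex_iso[OF f M] branching_vertex_iso[OF f' arborescence_merge_broom]
      branching_merge_broom[OF bad] branching_merge_broom[OF bad'] by simp
  then have "?M = ?M' \<or> ?M' = rooted_merge (broom n q) (broom m p)"
    by (auto simp: doubleton_eq_iff)
  then have "\<exists>g. vertex_iso g ?M ?M'"
  proof
    assume "?M = ?M'"
    then show ?thesis by (intro exI[of _ id]) (simp add: vertex_iso_def prod.map_id0)
  next
    assume swap: "?M' = rooted_merge (broom n q) (broom m p)"
    show ?thesis unfolding swap using vertex_iso_merge_commute by blast
  qed
  then obtain g where g: "vertex_iso g ?M ?M'" ..
  have "vertex_iso (f' \<circ> (g \<circ> the_inv_into (rverts ?M) f)) T T'"
    by (rule vertex_iso_comp[OF vertex_iso_comp[OF vertex_iso_inv g] f'])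
      (rule f arborescence_arcs_subset[OF M] arborescence_root[OF M])+
  then show ?thesis
    using rooted_iso_iff_vertex_iso[OF arborescence_arcs_subset[OF non_unimodal_arborescence[OF assms(1)]]]
    by blast
qed

text \<open>Classes are formed among all rooted digraphs on the natural numbers, so they are
  compared by composing isomorphisms with an arbitrary member \<open>U\<close>.\<close>

lemma rooted_iso_class_eq_iff:
  assumes "T \<in> non_unimodal_broom_merges i" "T' \<in> non_unimodal_broom_merges i"
  shows "{(T, T'). rooted_iso T T'} `` {T} = ({(T, T'). rooted_iso T T'} `` {T'} :: nat rooted_digraph set)
    \<longleftrightarrow> branching T = branching T'" (is "?L = ?R \<longleftrightarrow> _")
proof (intro iffI)
  note T = non_unimodal_arborescence[OF assms(1)] and T' = non_unimodal_arborescence[OF assms(2)]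
  note iso = rooted_iso_iff_vertex_iso[OF arborescence_arcs_subset[OF T]]
    and iso' = rooted_iso_iff_vertex_iso[OF arborescence_arcs_subset[OF T']]
  show "branching T = branching T'"
    if eq: "?L = ?R"
  proof -
    have "vertex_iso id T' T'" by (simp add: vertex_iso_def prod.map_id0)
    then have "T' \<in> ?R" using iso' by blast
    then have "rooted_iso T T'" using eq by blast
    then obtain f where f: "vertex_iso f T T'" using iso by blast
    show ?thesis using branching_vertex_iso[OF f T] by simp
  qed
  show "?L = ?R" if eq: "branching T = branching T'"
  proof -
    obtain f where f: "vertex_iso f T T'"
      using rooted_iso_if_branching_eq[OF assms eq] iso by blast
    obtain g where g: "vertex_iso g T' T"
      using rooted_iso_if_branching_eq[OF assms(2,1) eq[symmetric]] iso' by blast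
    have "rooted_iso T U \<longleftrightarrow> rooted_iso T' U" for U :: "nat rooted_digraph"
      using iso iso' vertex_iso_comp[OF f] vertex_iso_comp[OF g] by blast
    then show ?thesis by blast
  qed
qed

text \<open>One representative for each value of \<open>f\<close> gives a bijection onto the
  classes. Only classes of elements of \<open>X\<close> are compared, so \<open>R\<close> may reach
  outside \<open>X\<close>.\<close>

lemma card_quotient_eq_card_image:
  assumes "\<And>x y. x \<in> X \<Longrightarrow> y \<in> X \<Longrightarrow> R `` {x} = R `` {y} \<longleftrightarrow> f x = f y"
  shows "card (X // R) = card (f ` X)"
proof -
  have "bij_betw (\<lambda>y. R `` {inv_into X f y}) (f ` X) (X // R)"
    unfolding bij_betw_def
  proof
    show "inj_on (\<lambda>y. R `` {inv_into X f y}) (f ` X)"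
      by (rule inj_onI) (metis assms f_inv_into_f inv_into_into)
    show "(\<lambda>y. R `` {inv_into X f y}) ` f ` X = X // R"
    proof -
      have "R `` {inv_into X f (f x)} = R `` {x}" if "x \<in> X" for x
        using that assms[of "inv_into X f (f x)" x] by (simp add: f_inv_into_f inv_into_into)
      then show ?thesis unfolding quotient_def image_image by auto
    qed
  qed
  then show ?thesis by (simp add: bij_betw_same_card)
qed

lemma b_seq_eq: "b_seq i = card ((\<lambda>(a, b). {a, b}) ` non_unimodal_pairs i)"
  unfolding b_seq_def branching_image_non_unimodal_broom_merges[symmetric]
  by (rule card_quotient_eq_card_image) (rule rooted_iso_class_eq_iff)

theorem theorem5p2:
  shows "(\<forall>i\<in>{1..9}. b_seq i = 0) \<and>
    (\<forall>k::nat.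
      int (b_seq (2 * k + 10)) =
        2 * (\<Sum>i=0..k. \<lfloor>real (i * (i + 4)) / 4\<rfloor>) - \<lfloor>real (k\<^sup>2) / 4\<rfloor> \<and>
      int (b_seq (2 * k + 11)) =
        2 * (\<Sum>i=0..k. \<lfloor>real (i * (i + 4)) / 4\<rfloor>) + \<lfloor>real ((k + 1) * (k + 5)) / 4\<rfloor>
          - \<lfloor>real (k\<^sup>2) / 4\<rfloor>)"
  using non_unimodal_pairs_empty card_unordered_non_unimodal_even card_unordered_non_unimodal_odd
  by (simp only: b_seq_eq) simp

end
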